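(* For every integer $k\geq 1$ and for $n=7+12k+1$ as well as for $n=7+12k+2$, the triangulation $R_{k,n}$ (a triangulation with $n$ vertices of the orientable surface of Euler characteristic $\chi=-2kn$) is a non-neighborly cyclic triangulation, equivelar of type $\{3,q\}$, with $$q=6+12k=\left\lfloor\tfrac{1}{2}\left(5+\sqrt{49-24\chi}\right)\right\rfloor .$$ In particular, the two subseries $R_{k,7+12k+1}$ and $R_{k,7+12k+2}$, $k\ge 1$, provide infinitely many such examples. Moreover, by subdivision, these examples yield $2q$-covered triangulations of the same surfaces, with $d=2q=2\left\lfloor\tfrac{1}{2}\left(5+\sqrt{49-24\chi}\right)\right\rfloor$.
   Context: A triangulation of a closed surface $M$ is a finite simplicial complex whose underlying space is homeomorphic to $M$. It is equivelar of type $\{3,q\}$ ($q$-equivelar) if every vertex has degree $q$; neighborly if any two vertices are joined by an edge; $d$-covered if every edge has at least one endpoint of degree $d$. A triangulation with $n$ vertices is cyclic if the cyclic group $\mathbb{Z}_n$ acts on it by simplicial automorphisms and transitively on the vertices. "By subdivision" means stacking all triangles: for every triangle a new vertex is placed inside it and joined by edges to the three vertices of the triangle. Definition of $R_{k,n}$ ($k\ge 1$, $n\ge 7+12k$): the vertex set is $\mathbb{Z}_n=\{0,1,\dots,n-1\}$, and $R_{k,n}$ is the simplicial complex whose triangles are all translates $[a+t,b+t,c+t]$ (mod $n$), $t\in\mathbb{Z}_n$, of the following $2+4k$ generating triangles $[a,b,c]$: (i) $[0,2j-1,3k+2+j]$ and $[0,2j,3k+2+j]$ for $1\le j\le k$;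 (ii) $[0,4k+3,6k+3]$ and $[0,2k+2,4k+3]$; (iii) $[0,4k+3+j,6k+3-j]$ and $[0,4k+3+j,6k+4-j]$ for $1\le j\le k-1$ (none if $k=1$); (iv) $[0,2k+1,5k+3]$ and $[0,5k+3,5k+4]$. It is a triangulation of the orientable surface of genus $kn+1$, i.e. of Euler characteristic $-2kn$. *)

theory Defs
  imports
    "HOL-Analysis.Analysis"
    "HOL-Algebra.Group_Action"
    "HOL-Algebra.Elementary_Groups"
begin

text \<open>
  A finite abstract simplicial complex is the set of its nonempty faces; its vertex set is the union
  of its faces. (\<^const>\<open>simplicial_complex\<close> from the library is about geometric simplices in a fixed
  Euclidean space.)
\<close>

definition finite_complex :: "'a set set \<Rightarrow> bool" where
  "finite_complex K \<longleftrightarrow> finite K \<and> (\<forall>\<sigma>\<in>K. finite \<sigma> \<and> \<sigma> \<noteq> {}) \<and>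
     (\<forall>\<sigma>\<in>K. \<forall>\<tau>. \<tau> \<noteq> {} \<and> \<tau> \<subseteq> \<sigma> \<longrightarrow> \<tau> \<in> K)"

abbreviation vertices :: "'a set set \<Rightarrow> 'a set" where
  "vertices K \<equiv> \<Union>K"

definition edges :: "'a set set \<Rightarrow> 'a set set" where
  "edges K = {\<sigma>\<in>K. card \<sigma> = 2}"

definition triangles :: "'a set set \<Rightarrow> 'a set set" where
  "triangles K = {\<sigma>\<in>K. card \<sigma> = 3}"

definition degree_in :: "'a set set \<Rightarrow> 'a \<Rightarrow> nat" where
  "degree_in K v = card {e \<in> edges K. v \<in> e}"

text \<open>
  The underlying space: points are given by their barycentric coordinates, extended by 0. The product
  topology on \<^typ>\<open>'a \<Rightarrow> real\<close> induces the usual topology because only finitely many coordinates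
  are ever nonzero when \<^term>\<open>K\<close> is finite.
\<close>

definition underlying_space :: "'a set set \<Rightarrow> ('a \<Rightarrow> real) topology" where
  "underlying_space K =
     top_of_set {x. (\<forall>v. 0 \<le> x v) \<and> {v. x v \<noteq> 0} \<in> K \<and> (\<Sum>v | x v \<noteq> 0. x v) = 1}"

text \<open>Closed surfaces are connected, and compact without boundary.\<close>

definition closed_surface :: "'b topology \<Rightarrow> bool" where
  "closed_surface M \<longleftrightarrow>
     topspace M \<noteq> {} \<and> Hausdorff_space M \<and> second_countable M \<and> compact_space M \<and> connected_space M \<and>
     (\<forall>x\<in>topspace M. \<exists>U W. openin M U \<and> x \<in> U \<and> open (W :: (real^2) set) \<and>
        subtopology M U homeomorphic_space top_of_set W)"

definition triangulates :: "'a set set \<Rightarrow> 'b topology \<Rightarrow> bool" where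
  "triangulates K M \<longleftrightarrow>
     finite_complex K \<and> closed_surface M \<and> underlying_space K homeomorphic_space M"

definition euler_char :: "'a set set \<Rightarrow> int" where
  "euler_char K = (\<Sum>\<sigma>\<in>K. (-1) ^ (card \<sigma> - 1))"

text \<open>
  Orientability of a triangulated surface by a coherent orientation of the triangles: every triangle
  is given one of its two cyclic orders, recorded as a set of three directed edges, so that two
  triangles with a common edge induce opposite directions on it.
\<close>

definition orientable :: "'a set set \<Rightarrow> bool" where
  "orientable K \<longleftrightarrow>
     (\<exists>ori :: 'a set \<Rightarrow> ('a \<times> 'a) set.
        (\<forall>\<sigma>\<in>triangles K. \<exists>a b c. \<sigma> = {a, b, c} \<and> ori \<sigma> = {(a, b), (b, c), (c, a)}) \<and>
        (\<forall>\<sigma>\<in>triangles K. \<forall>\<tau>\<in>triangles K. \<sigma> \<noteq> \<tau> \<longrightarrow> ori \<sigma> \<inter> ori \<tau> = {}))"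

definition equivelar :: "nat \<Rightarrow> 'a set set \<Rightarrow> bool" where
  "equivelar q K \<longleftrightarrow> (\<forall>v\<in>vertices K. degree_in K v = q)"

definition neighborly :: "'a set set \<Rightarrow> bool" where
  "neighborly K \<longleftrightarrow> (\<forall>u\<in>vertices K. \<forall>v\<in>vertices K. u \<noteq> v \<longrightarrow> {u, v} \<in> edges K)"

definition covered :: "nat \<Rightarrow> 'a set set \<Rightarrow> bool" where
  "covered d K \<longleftrightarrow> (\<forall>e\<in>edges K. \<exists>v\<in>e. degree_in K v = d)"

definition cyclic :: "'a set set \<Rightarrow> bool" where
  "cyclic K \<longleftrightarrow>
     (\<exists>\<phi>. transitive_action (integer_mod_group (card (vertices K))) (vertices K) \<phi> \<and>
        (\<forall>g \<in> carrier (integer_mod_group (card (vertices K))). (\<lambda>\<sigma>. \<phi> g ` \<sigma>) ` K = K))"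

definition isomorphic :: "'a set set \<Rightarrow> 'b set set \<Rightarrow> bool" where
  "isomorphic K L \<longleftrightarrow>
     (\<exists>f. bij_betw f (vertices K) (vertices L) \<and> (\<lambda>\<sigma>. f ` \<sigma>) ` K = L)"

text \<open>
  Stacking all triangles: each triangle \<^term>\<open>\<sigma>\<close> is replaced by the cone over its boundary with
  the new vertex \<^term>\<open>Inr \<sigma>\<close> as apex; \<^term>\<open>\<tau> = {}\<close> gives the new vertex itself.
\<close>

definition stack_all :: "'a set set \<Rightarrow> ('a + 'a set) set set" where
  "stack_all K =
     {Inl ` \<tau> | \<tau>. \<tau> \<in> K - triangles K} \<union>
     {insert (Inr \<sigma>) (Inl ` \<tau>) | \<sigma> \<tau>. \<sigma> \<in> triangles K \<and> \<tau> \<subset> \<sigma>}"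

text \<open>The residues modulo \<^term>\<open>n\<close> are represented by the natural numbers below \<^term>\<open>n\<close>.\<close>

definition R_generators :: "nat \<Rightarrow> nat set set" where
  "R_generators k =
     (\<Union>j\<in>{1..k}. {{0, 2*j - 1, 3*k + 2 + j}, {0, 2*j, 3*k + 2 + j}}) \<union>
     {{0, 4*k + 3, 6*k + 3}, {0, 2*k + 2, 4*k + 3}} \<union>
     (\<Union>j\<in>{1..k-1}. {{0, 4*k + 3 + j, 6*k + 3 - j}, {0, 4*k + 3 + j, 6*k + 4 - j}}) \<union>
     {{0, 2*k + 1, 5*k + 3}, {0, 5*k + 3, 5*k + 4}}"

definition R_triangles :: "nat \<Rightarrow> nat \<Rightarrow> nat set set" where
  "R_triangles k n = {(\<lambda>x. (x + t) mod n) ` \<sigma> | \<sigma> t. \<sigma> \<in> R_generators k \<and> t < n}"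

definition R_complex :: "nat \<Rightarrow> nat \<Rightarrow> nat set set" where
  "R_complex k n = {\<tau>. \<tau> \<noteq> {} \<and> (\<exists>\<sigma>\<in>R_triangles k n. \<tau> \<subseteq> \<sigma>)}"

end

theory Submission
  imports Defs "HOL-Combinatorics.Orbits"
begin

text \<open>
  The heart of the matter is the link of a vertex of \<^term>\<open>R_complex k n\<close>. All generating triangles are
  triangles of integers with differences of absolute value at most \<open>6 * k + 3\<close>, and there are \<open>12 * k + 6\<close>
  nonzero differences of this size. Oriented suitably, the generating triangles define a successor map
  \<open>rho k\<close> on these differences: \<open>rho k d\<close> is the third vertex of the oriented triangle with the directed edge
  from 0 to \<open>d\<close>. Following this map explicitly shows that it is a single cycle (\<open>cyclic_on_rho\<close>), and
  for \<open>n \<ge> 12 * k + 7\<close> reduction modulo \<open>n\<close> is injective on the differences. By translation, the link of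
  every vertex is a cycle of length \<open>12 * k + 6\<close>. The coherence relation \<open>rho_rho_diff\<close>, which expresses that an
  oriented triangle may be read from each of its vertices, gives orientability.

  A finite connected complex in which all vertex links are cycles triangulates a closed surface
  (\<open>closed_surface_if_link_cycles\<close>): the open star of a vertex is homeomorphic to an open disk, by an
  explicit map that is linear on the rays of the disk and piecewise linear in the angle. Double counting yields the
  Euler characteristic from the common degree \<open>q = 12 * k + 6\<close>; a vertex has fewer than \<open>n - 1\<close>
  neighbours, so the complex is not neighborly; and the formula for \<open>q\<close> is an estimate of a square root.

  Stacking all triangles does not change the underlying space (\<open>stack_all_homeomorphic\<close>). It adds to the
  degree of every old vertex the number of triangles at this vertex, which is again \<open>q\<close>, and every edge of the stacked
  complex contains an old vertex; hence it is covered by vertices of degree \<open>2 * q\<close>. Complexes for different \<open>k\<close>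
  have different numbers of vertices.
\<close>

section \<open>The star of a vertex whose link is a cycle\<close>

text \<open>
  The closed unit disk is divided into \<open>m\<close> equal sectors by the rays through the \<open>m\<close>-th roots of unity.
  On a circle about the origin, and for \<open>3 \<le> m\<close>, \<open>hat m i\<close> is the piecewise linear function of the angle that peaks at the \<open>i\<close>-th
  ray and vanishes outside the two sectors next to it. The angle between a point and the ray is measured
  by \<^const>\<open>arccos\<close>, which makes continuity across all rays automatic; the factor \<open>norm p\<close> makes the
  function continuous at 0 as well, where the quotient has the value 0.
\<close>

definition hat :: "nat \<Rightarrow> nat \<Rightarrow> complex \<Rightarrow> real" where
  "hat m i p =
     norm p * max 0 (1 - m / (2 * pi) * arccos (Re (p * cnj (cis (2 * pi * real i / m))) / norm p))"

lemma hat_cosine_bounds: "- 1 \<le> Re (p * cnj (cis t)) / norm p \<and> Re (p * cnj (cis t)) / norm p \<le> 1"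
proof -
  have "\<bar>Re (p * cnj (cis t))\<bar> \<le> norm p"
    using abs_Re_le_cmod[of "p * cnj (cis t)"] by (simp add: norm_mult del: times_complex.sel)
  then show ?thesis by (cases "p = 0") (auto simp: divide_simps abs_le_iff simp del: times_complex.sel)
qed

lemma abs_hat_le: "\<bar>hat m i p\<bar> \<le> norm p"
proof -
  let ?c = "Re (p * cnj (cis (2 * pi * real i / m))) / norm p"
  have "- 1 \<le> ?c \<and> ?c \<le> 1"
    by (rule hat_cosine_bounds)
  then have "0 \<le> arccos ?c" using arccos_lbound by blast
  then have "0 \<le> m / (2 * pi) * arccos ?c" by auto
  then have "0 \<le> max 0 (1 - m / (2 * pi) * arccos ?c)" "max 0 (1 - m / (2 * pi) * arccos ?c) \<le> 1" by linarith+
  then have "norm p * max 0 (1 - m / (2 * pi) * arccos ?c) \<le> norm p"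
    "0 \<le> norm p * max 0 (1 - m / (2 * pi) * arccos ?c)"
    by (simp_all add: mult_left_le)
  then show ?thesis unfolding hat_def by simp
qed

lemma continuous_on_hat: "continuous_on UNIV (hat m i)"
proof -
  have "continuous_on (- {0}) (hat m i)"
    unfolding hat_def
  proof (intro continuous_intros)
    show "\<forall>p\<in>- {0}. - 1 \<le> Re (p * cnj (cis (2 * pi * real i / m))) / norm p \<and>
        Re (p * cnj (cis (2 * pi * real i / m))) / norm p \<le> 1"
      using hat_cosine_bounds by blast
  qed auto
  then have away: "isCont (hat m i) p" if "p \<noteq> 0" for p
    using that continuous_on_eq_continuous_at[of "- {0}" "hat m i"] by (simp add: open_Compl)
  have "(hat m i \<longlongrightarrow> 0) (at 0)"
  proof (rule Lim_null_comparison)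
    show "\<forall>\<^sub>F p in at 0. norm (hat m i p) \<le> norm p" by (simp add: abs_hat_le)
    show "((\<lambda>p::complex. norm p) \<longlongrightarrow> 0) (at 0)" by (rule tendsto_eq_intros refl)+ simp
  qed
  moreover have "hat m i 0 = 0" by (simp add: hat_def)
  ultimately have "isCont (hat m i) 0" by (simp add: isCont_def)
  with away show ?thesis by (metis continuous_at_imp_continuous_on)
qed

text \<open>
  The angle \<open>x\<close> may exceed \<open>pi\<close>; the bounds are symmetric under \<open>x\<close> going to \<open>2 * pi - x\<close>.
\<close>

lemma arccos_cos_ge:
  assumes "0 \<le> a" "a \<le> pi" "a \<le> x" "x \<le> 2 * pi - a"
  shows "a \<le> arccos (cos x)"
proof -
  have "arccos (cos x) = x \<or> arccos (cos x) = 2 * pi - x"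
  proof (cases "x \<le> pi")
    case True then show ?thesis using assms by (simp add: arccos_cos)
  next
    case False
    have "cos x = cos (2 * pi - x)" by (simp add: cos_diff)
    moreover have "arccos (cos (2 * pi - x)) = 2 * pi - x"
      using False assms by (intro arccos_cos) auto
    ultimately show ?thesis by simp
  qed
  then show ?thesis using assms by auto
qed

text \<open>
  The polar angle is \<open>j + s\<close> in units of a sector, so \<open>s\<close> interpolates linearly between the rays \<open>j\<close> and \<open>j + 1\<close>.
  The assumption \<open>3 \<le> m\<close> ensures that a sector angle is less than \<open>pi\<close>.
\<close>

lemma hat_polar:
  assumes m: "3 \<le> m" and i: "i < m" and j: "j < m" and s: "0 \<le> s" "s \<le> 1" and r: "0 \<le> r"
  shows "hat m i (rcis r (2 * pi / m * (real j + s))) =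
    r * (if i = j then 1 - s else if i = Suc j mod m then s else 0)"
proof (cases "r = 0")
  case True then show ?thesis by (simp add: hat_def)
next
  case False
  with r have r: "0 < r" by simp
  define a where "a = 2 * pi / m"
  have a: "0 < a" "3 * a \<le> 2 * pi" "m * a = 2 * pi"
    using m by (auto simp: a_def field_simps)
  have "Re (rcis r (a * (real j + s)) * cnj (cis (a * real i))) = r * cos (a * (real j + s - real i))"
    by (simp add: right_diff_distrib cos_diff algebra_simps)
  then have hat: "hat m i (rcis r (2 * pi / m * (real j + s))) =
      r * max 0 (1 - arccos (cos (a * (real j + s - real i))) / a)"
    using r by (simp add: hat_def a_def mult.commute)
  have sa: "0 \<le> a * s" "a * s \<le> a" "0 \<le> a * (1 - s)" "a * (1 - s) \<le> a" using a s by (auto simp: mult_left_le)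
  have sa_pi: "a * s \<le> pi" "a * (1 - s) \<le> pi" using sa a by linarith+
  consider "i = j" | "i \<noteq> j" "i = Suc j mod m" | "i \<noteq> j" "i \<noteq> Suc j mod m" by blast
  then show ?thesis
  proof cases
    case 1
    have "arccos (cos (a * s)) = a * s" using sa sa_pi by (intro arccos_cos)
    then show ?thesis using 1 a s unfolding hat by simp
  next
    case 2
    have "cos (a * (real j + s - real i)) = cos (a * (1 - s))"
    proof (cases "Suc j < m")
      case True
      then have "a * (real j + s - real i) = - (a * (1 - s))" using 2 by (simp add: algebra_simps)
      then show ?thesis by (simp only: cos_minus)
    next
      case False
      with j have "Suc j = m" by simp
      with 2 have jm: "i = 0" "Suc j = m" by auto
      then have "a * (real j + s - real i) = 2 * pi - a * (1 - s)" using a(3)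
        by (auto simp: algebra_simps)
      then show ?thesis by (simp add: cos_diff)
    qed
    moreover have "arccos (cos (a * (1 - s))) = a * (1 - s)" using sa sa_pi by (intro arccos_cos)
    ultimately show ?thesis using 2 a s unfolding hat by simp
  next
    case 3
    \<comment> \<open>the number of sectors from ray \<open>j\<close> on to ray \<open>i\<close>; the two adjacent rays are excluded\<close>
    define d where "d = (if j < i then i - j else i + m - j)"
    have d: "2 \<le> d" "d \<le> m - 1"
      using 3 i j m by (auto simp: d_def mod_if split: if_splits)
    have "cos (a * (real j + s - real i)) = cos (a * (real d - s))"
    proof (cases "j < i")
      case True
      then have "a * (real j + s - real i) = - (a * (real d - s))"
        by (simp add: d_def of_nat_diff algebra_simps)
      then show ?thesis by (simp only: cos_minus)
    next
      case False
      then have "a * (real j + s - real i) = 2 * pi - a * (real d - s)"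
        using j a(3) by (simp add: d_def of_nat_diff algebra_simps)
      then show ?thesis by (simp add: cos_diff)
    qed
    moreover have "a \<le> arccos (cos (a * (real d - s)))"
    proof (rule arccos_cos_ge)
      have "a * 1 \<le> a * (real d - s)" using a d s by (intro mult_left_mono) auto
      then show "a \<le> a * (real d - s)" by simp
      have "real d \<le> real m - 1" using d m by linarith
      then have "a * (real d - s) \<le> a * (real m - 1)" using a s by (intro mult_left_mono) auto
      then show "a * (real d - s) \<le> 2 * pi - a" using a by (simp add: algebra_simps)
    qed (use a in auto)
    ultimately show ?thesis using 3 a r unfolding hat by (simp add: max_def)
  qed
qed

lemma complex_sector:
  fixes p :: complex and m :: nat
  assumes "0 < m"
  obtains j s where "j < m" "0 \<le> s" "s < 1" "p = rcis (norm p) (2 * pi / m * (real j + s))"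
proof -
  define t where "t = m * Arg2pi p / (2 * pi)"
  have t: "0 \<le> t" "t < m"
    using Arg2pi_ge_0[of p] Arg2pi_lt_2pi[of p] assms by (auto simp: t_def field_simps)
  have "p = rcis (norm p) (Arg2pi p)"
    using Arg2pi_eq[of p] by (simp add: rcis_def cis_conv_exp)
  moreover have "Arg2pi p = 2 * pi / m * (real (nat \<lfloor>t\<rfloor>) + frac t)"
    using assms t by (simp add: t_def frac_def)
  moreover have "nat \<lfloor>t\<rfloor> < m" using t by linarith
  ultimately show ?thesis
    using that[of "nat \<lfloor>t\<rfloor>" "frac t"] frac_ge_0 frac_lt_1 by metis
qed

text \<open>
  The point set of the underlying space, in barycentric coordinates.
\<close>

definition realization :: "'a set set \<Rightarrow> ('a \<Rightarrow> real) set" where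
  "realization K = {x. (\<forall>v. 0 \<le> x v) \<and> {v. x v \<noteq> 0} \<in> K \<and> (\<Sum>v | x v \<noteq> 0. x v) = 1}"

text \<open>
  The point of the triangle \<open>v a b\<close> that lies at the proportion \<open>r\<close> of the segment from \<open>v\<close> to the point with
  weights \<open>1 - s\<close> and \<open>s\<close> at \<open>a\<close> and \<open>b\<close>.
\<close>

definition tri_point :: "'a \<Rightarrow> 'a \<Rightarrow> 'a \<Rightarrow> real \<Rightarrow> real \<Rightarrow> 'a \<Rightarrow> real" where
  "tri_point v a b r s =
    (\<lambda>x. if x = v then 1 - r else if x = a then r * (1 - s) else if x = b then r * s else 0)"

text \<open>
  If the link of \<open>v\<close> is the cycle \<open>w 0, \<dots>, w (m - 1)\<close>, this maps the unit disk onto the star of \<open>v\<close>: the origin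
  goes to \<open>v\<close>, the \<open>i\<close>-th root of unity goes to \<open>w i\<close>, and every sector goes to a triangle.
\<close>

definition star_map :: "'a \<Rightarrow> (nat \<Rightarrow> 'a) \<Rightarrow> nat \<Rightarrow> complex \<Rightarrow> 'a \<Rightarrow> real" where
  "star_map v w m p = (\<lambda>x. if x = v then 1 - norm p else (\<Sum>i | i < m \<and> w i = x. hat m i p))"

lemma continuous_on_star_map: "continuous_on S (star_map v w m)"
  unfolding star_map_def
proof (rule continuous_on_coordinatewise_then_product)
  fix x
  have "continuous_on S (hat m i)" for i
    using continuous_on_hat continuous_on_subset by blast
  then show "continuous_on S (\<lambda>p. if x = v then 1 - norm p else (\<Sum>i | i < m \<and> w i = x. hat m i p))"
    by (cases "x = v") (auto intro!: continuous_intros)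
qed

context
  fixes v :: 'a and w :: "nat \<Rightarrow> 'a" and m :: nat
  assumes m: "3 \<le> m" and inj: "inj_on w {..<m}" and v: "v \<notin> w ` {..<m}"
begin

lemma m_pos: "0 < m"
  using m by simp

lemma Suc_mod: "j < m \<Longrightarrow> Suc j mod m < m" "j < m \<Longrightarrow> Suc j mod m \<noteq> j"
  using m by (auto simp: mod_if)

lemma star_map_polar:
  assumes "j < m" "0 \<le> s" "s \<le> 1" "0 \<le> r"
  shows "star_map v w m (rcis r (2 * pi / m * (real j + s))) = tri_point v (w j) (w (Suc j mod m)) r s"
proof
  fix x
  let ?p = "rcis r (2 * pi / m * (real j + s))"
  note hp = hat_polar[OF m _ assms(1) assms(2) assms(3) assms(4)]
  consider "x = v" | i where "x \<noteq> v" "i < m" "x = w i" | "x \<noteq> v" "x \<notin> w ` {..<m}" by blast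
  then show "star_map v w m ?p x = tri_point v (w j) (w (Suc j mod m)) r s x"
  proof cases
    case 1 then show ?thesis using assms by (simp add: star_map_def tri_point_def)
  next
    case 2
    then have "{i'. i' < m \<and> w i' = x} = {i}" using inj by (auto simp: inj_on_def)
    moreover have "w i = w j \<longleftrightarrow> i = j" "w i = w (Suc j mod m) \<longleftrightarrow> i = Suc j mod m"
      using inj 2 Suc_mod[OF assms(1)] assms(1) by (auto simp: inj_on_def)
    ultimately show ?thesis using 2 hp[OF 2(2)] by (simp add: star_map_def tri_point_def)
  next
    case 3
    then have "{i'. i' < m \<and> w i' = x} = {}" "x \<noteq> w j" "x \<noteq> w (Suc j mod m)"
      using assms(1) Suc_mod[OF assms(1)] by auto
    then show ?thesis using 3 by (simp only: star_map_def tri_point_def if_False sum.empty)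
  qed
qed

lemma link_vertex_neq: "j < m \<Longrightarrow> w j \<noteq> v" "j < m \<Longrightarrow> w (Suc j mod m) \<noteq> v"
    "j < m \<Longrightarrow> w (Suc j mod m) \<noteq> w j"
proof -
  assume j: "j < m"
  then have "w j \<in> w ` {..<m}" "w (Suc j mod m) \<in> w ` {..<m}" using Suc_mod(1) by auto
  then show "w j \<noteq> v" "w (Suc j mod m) \<noteq> v" using v by auto
  show "w (Suc j mod m) \<noteq> w j"
    using inj j Suc_mod[OF j] by (metis inj_on_def lessThan_iff)
qed

lemma inj_star_map: "inj (star_map v w m)"
proof (rule injI)
  fix p p' assume eq: "star_map v w m p = star_map v w m p'"
  obtain j s where js: "j < m" "0 \<le> s" "s < 1" "p = rcis (norm p) (2 * pi / m * (real j + s))"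
    using complex_sector[OF m_pos, of p] by blast
  obtain j' s' where js': "j' < m" "0 \<le> s'" "s' < 1" "p' = rcis (norm p') (2 * pi / m * (real j' + s'))"
    using complex_sector[OF m_pos, of p'] by blast
  have "star_map v w m p v = star_map v w m p' v" by (simp add: eq)
  then have r: "norm p = norm p'" by (simp add: star_map_def)
  show "p = p'"
  proof (cases "p = 0")
    case False
    then have r0: "0 < norm p" by simp
    let ?q = "tri_point v (w j) (w (Suc j mod m)) (norm p) s"
    let ?q' = "tri_point v (w j') (w (Suc j' mod m)) (norm p) s'"
    have "?q = star_map v w m p"
      using star_map_polar[OF js(1,2) less_imp_le[OF js(3)] norm_ge_zero[of p]] js(4) by simp
    moreover have "?q' = star_map v w m p'"
      using star_map_polar[OF js'(1,2) less_imp_le[OF js'(3)] norm_ge_zero[of p]] js'(4) r by simp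
    ultimately have "?q = ?q'" using eq by simp
    then have "?q (w j) = ?q' (w j)" "?q (w j') = ?q' (w j')" by simp_all
    then have "w j = w j' \<or> w j = w (Suc j' mod m)" "w j' = w j \<or> w j' = w (Suc j mod m)"
      using js js' r0 link_vertex_neq by (auto simp: tri_point_def split: if_splits)
    then have "j = j' \<or> j = Suc j' mod m" "j' = j \<or> j' = Suc j mod m"
      using inj js js' Suc_mod by (auto simp: inj_on_def)
    then have jj: "j = j'" using m js(1) js'(1) by (auto simp: mod_if split: if_splits)
    with \<open>?q (w j) = ?q' (w j)\<close> have "s = s'"
      using r0 js link_vertex_neq by (auto simp: tri_point_def)
    with jj r js js' show ?thesis by metis
  qed (use r in simp)
qed

text \<open>
  The open disk is mapped onto the open star of \<open>v\<close>, the points with positive coordinate at \<open>v\<close>.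
\<close>

lemma star_map_image:
  assumes K: "{\<sigma>\<in>K. v \<in> \<sigma>} = insert {v} ({{v, w i} | i. i < m} \<union> {{v, w i, w (Suc i mod m)} | i. i < m})"
  shows "star_map v w m ` ball 0 1 = {x \<in> realization K. 0 < x v}" (is "?L = ?R")
proof
  show "?L \<subseteq> ?R"
  proof
    fix x assume "x \<in> ?L"
    then obtain p where p: "norm p < 1" "x = star_map v w m p" by auto
    obtain j s where js: "j < m" "0 \<le> s" "s < 1" "p = rcis (norm p) (2 * pi / m * (real j + s))"
      using complex_sector[OF m_pos, of p] by blast
    define r where "r = norm p"
    have r: "0 \<le> r" "r < 1" using p by (auto simp: r_def)
    have x: "x = tri_point v (w j) (w (Suc j mod m)) r s"
      using star_map_polar[OF js(1,2) less_imp_le[OF js(3)] r(1)] js(4) p(2) by (simp add: r_def)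
    note neq = link_vertex_neq[OF js(1)]
    have supp: "{y. x y \<noteq> 0} \<subseteq> {v, w j, w (Suc j mod m)}" by (auto simp: x tri_point_def split: if_splits)
    have "{y. x y \<noteq> 0} = (if r = 0 then {v} else if s = 0 then {v, w j} else {v, w j, w (Suc j mod m)})"
      using r js neq by (auto simp: x tri_point_def split: if_splits)
    then have "{y. x y \<noteq> 0} \<in> {\<sigma>\<in>K. v \<in> \<sigma>}" unfolding K using js(1) by auto
    then have "{y. x y \<noteq> 0} \<in> K" by simp
    moreover have "(\<Sum>y | x y \<noteq> 0. x y) = (\<Sum>y\<in>{v, w j, w (Suc j mod m)}. x y)"
      using supp by (intro sum.mono_neutral_left) auto
    moreover have "\<dots> = 1" using neq by (auto simp: x tri_point_def algebra_simps)
    moreover have "0 \<le> x y" for y using r js by (auto simp: x tri_point_def)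
    moreover have "0 < x v" using r by (simp add: x tri_point_def)
    ultimately show "x \<in> ?R" by (simp add: realization_def)
  qed
  show "?R \<subseteq> ?L"
  proof
    fix x assume "x \<in> ?R"
    then have nonneg: "\<And>y. 0 \<le> x y" and "{y. x y \<noteq> 0} \<in> {\<sigma>\<in>K. v \<in> \<sigma>}"
      and sum: "(\<Sum>y | x y \<noteq> 0. x y) = 1" and xv: "0 < x v"
      by (auto simp: realization_def)
    then have "\<exists>j<m. {y. x y \<noteq> 0} \<subseteq> {v, w j, w (Suc j mod m)}"
      unfolding K using m_pos by blast
    then obtain j where j: "j < m" and supp: "{y. x y \<noteq> 0} \<subseteq> {v, w j, w (Suc j mod m)}" by blast
    define r where "r = 1 - x v"
    define s where "s = x (w (Suc j mod m)) / r"
    note neq = link_vertex_neq[OF j]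
    have "(\<Sum>y | x y \<noteq> 0. x y) = (\<Sum>y\<in>{v, w j, w (Suc j mod m)}. x y)"
      using supp by (intro sum.mono_neutral_left) auto
    with sum have sum3: "x v + x (w j) + x (w (Suc j mod m)) = 1"
      using neq by (auto simp: algebra_simps)
    have r: "0 \<le> r" "r < 1" "x (w (Suc j mod m)) \<le> r"
      using sum3 xv nonneg[of "w j"] nonneg[of "w (Suc j mod m)"] by (auto simp: r_def)
    have s: "0 \<le> s" "s \<le> 1" using r nonneg by (auto simp: s_def divide_simps)
    have rs: "r * s = x (w (Suc j mod m))"
      using r nonneg[of "w (Suc j mod m)"] by (auto simp: s_def)
    have "x = tri_point v (w j) (w (Suc j mod m)) r s"
    proof
      fix y
      have "r * (1 - s) = x (w j)" using rs sum3 by (simp add: r_def algebra_simps)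
      then show "x y = tri_point v (w j) (w (Suc j mod m)) r s y"
        using rs supp by (auto simp: tri_point_def r_def)
    qed
    then have "x = star_map v w m (rcis r (2 * pi / m * (real j + s)))"
      using star_map_polar[OF j s r(1)] by simp
    moreover have "norm (rcis r (2 * pi / m * (real j + s))) < 1" using r by simp
    ultimately show "x \<in> ?L" by auto
  qed
qed

end

section \<open>Complexes with cyclic vertex links are closed surfaces\<close>

lemma underlying_space_eq: "underlying_space K = top_of_set (realization K)"
  by (simp add: underlying_space_def realization_def)

lemma finite_complex_face: "finite_complex K \<Longrightarrow> \<sigma> \<in> K \<Longrightarrow> \<tau> \<subseteq> \<sigma> \<Longrightarrow> \<tau> \<noteq> {} \<Longrightarrow> \<tau> \<in> K"
  unfolding finite_complex_def by blast

lemma finite_complex_finite: "finite_complex K \<Longrightarrow> \<sigma> \<in> K \<Longrightarrow> finite \<sigma>"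
  unfolding finite_complex_def by blast

lemma homeomorphism_imp_homeomorphic_space:
  assumes "homeomorphism S T f g"
  shows "top_of_set S homeomorphic_space top_of_set T"
  using assms unfolding homeomorphic_space_def homeomorphic_maps_def homeomorphism_def
  by (intro exI[of _ f] exI[of _ g]) auto

text \<open>
  The link of \<open>v\<close> is a cycle with vertex set \<open>L\<close>, and \<open>f\<close> is the successor map of this cycle; in addition,
  all faces at \<open>v\<close> are faces of triangles at \<open>v\<close>. The orientation of the cycle is part of the data.
\<close>

definition link_cycle :: "'a set set \<Rightarrow> 'a \<Rightarrow> ('a \<Rightarrow> 'a) \<Rightarrow> 'a set \<Rightarrow> bool" where
  "link_cycle K v f L \<longleftrightarrow> cyclic_on f L \<and> 3 \<le> card L \<and> v \<notin> L \<and>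
     {\<sigma>\<in>K. v \<in> \<sigma>} = insert {v} ({{v, x} | x. x \<in> L} \<union> {{v, x, f x} | x. x \<in> L})"

lemma cyclic_on_enumerate:
  assumes "cyclic_on f L"
  obtains w :: "nat \<Rightarrow> 'a" where "bij_betw w {..<card L} L" "\<And>i. i < card L \<Longrightarrow> f (w i) = w (Suc i mod card L)"
proof -
  obtain a where a: "L = orbit f a" "a \<in> orbit f a" using assms by (auto simp: cyclic_on_def)
  define m where "m = funpow_dist1 f a a"
  let ?w = "\<lambda>i. (f ^^ i) a"
  have inj: "inj_on ?w {0..<m}" using inj_on_funpow_dist1[OF a(2)] by (simp add: m_def)
  have L: "L = ?w ` {0..<m}" using orbit_conv_funpow_dist1[OF a(2)] a(1) by (simp add: m_def)
  have card: "card L = m" using inj L by (simp add: card_image)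
  have m: "?w m = a" using funpow_dist1_prop[OF a(2)] by (simp add: m_def)
  show ?thesis
  proof (rule that)
    show "bij_betw ?w {..<card L} L" using inj L card by (simp add: bij_betw_def atLeast0LessThan)
    fix i assume "i < card L"
    then have "Suc i < m \<or> Suc i = m" using card by auto
    moreover have "f (?w i) = ?w (Suc i)" by simp
    ultimately show "f (?w i) = ?w (Suc i mod card L)"
      using m unfolding card by (metis funpow_0 mod_less mod_self)
  qed
qed

text \<open>
  The map of the closed disk is a homeomorphism onto its image because the disk is compact.
\<close>

lemma open_star_disk:
  fixes K :: "'a::countable set set"
  assumes "link_cycle K v f L"
  obtains g h where "homeomorphism (ball (0::complex) 1) {x \<in> realization K. 0 < x v} g h"
proof -
  define m where "m = card L"
  have m: "3 \<le> m" using assms by (simp add: link_cycle_def m_def)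
  obtain w where bij: "bij_betw w {..<m} L" and w: "\<And>i. i < m \<Longrightarrow> f (w i) = w (Suc i mod m)"
    using cyclic_on_enumerate assms unfolding link_cycle_def m_def by metis
  have inj: "inj_on w {..<m}" and L: "L = w ` {..<m}" using bij by (auto simp: bij_betw_def)
  have v: "v \<notin> w ` {..<m}" using assms L by (simp add: link_cycle_def)
  have "{{v, x} | x. x \<in> L} = {{v, w i} | i. i < m}" unfolding L by force
  moreover have "{{v, x, f x} | x. x \<in> L} = {{v, w i, w (Suc i mod m)} | i. i < m}"
  proof (intro equalityI subsetI)
    fix \<sigma> assume "\<sigma> \<in> {{v, x, f x} | x. x \<in> L}"
    then obtain x where x: "x \<in> L" "\<sigma> = {v, x, f x}" by blast
    then obtain i where i: "i < m" "x = w i" unfolding L by auto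
    then have "\<sigma> = {v, w i, w (Suc i mod m)}" using x w by simp
    with i show "\<sigma> \<in> {{v, w i, w (Suc i mod m)} | i. i < m}" by blast
  next
    fix \<sigma> assume "\<sigma> \<in> {{v, w i, w (Suc i mod m)} | i. i < m}"
    then obtain i where "i < m" "\<sigma> = {v, w i, w (Suc i mod m)}" by blast
    then have "w i \<in> L" "\<sigma> = {v, w i, f (w i)}" using w[of i] by (simp_all add: L)
    then show "\<sigma> \<in> {{v, x, f x} | x. x \<in> L}" by blast
  qed
  ultimately have K: "{\<sigma>\<in>K. v \<in> \<sigma>} =
      insert {v} ({{v, w i} | i. i < m} \<union> {{v, w i, w (Suc i mod m)} | i. i < m})"
    using assms by (simp add: link_cycle_def)
  let ?s = "star_map v w m"
  have "inj_on ?s (cball 0 1)" using inj_star_map[OF m inj v] inj_on_subset by blast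
  then obtain h where "homeomorphism (cball 0 1) (?s ` cball 0 1) ?s h"
    using homeomorphism_compact[OF compact_cball continuous_on_star_map refl] by blast
  then have "homeomorphism (ball 0 1) (?s ` ball 0 1) ?s h"
    by (rule homeomorphism_of_subsets) auto
  then show ?thesis using that star_map_image[OF m inj v K] by metis
qed

text \<open>
  The complex plane is replaced by the coordinate plane of the definition of a surface.
\<close>

lemma star_plane:
  fixes K :: "'a::countable set set"
  assumes "link_cycle K v f L"
  obtains W :: "(real^2) set" where "open W" "top_of_set {x \<in> realization K. 0 < x v} homeomorphic_space top_of_set W"
proof -
  have "(UNIV :: complex set) homeomorphic (UNIV :: (real^2) set)"
    by (rule homeomorphic_subspaces) (auto simp: dim_UNIV)
  then obtain a b where ab: "homeomorphism (UNIV :: complex set) (UNIV :: (real^2) set) a b"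
    by (auto simp: homeomorphic_def)
  obtain g h where gh: "homeomorphism (ball (0::complex) 1) {x \<in> realization K. 0 < x v} g h"
    using open_star_disk[OF assms] by blast
  have "homeomorphism (ball 0 1) (a ` ball 0 1) a b"
    using ab by (rule homeomorphism_of_subsets) auto
  then have 1: "top_of_set (ball (0::complex) 1) homeomorphic_space top_of_set (a ` ball 0 1)"
    by (rule homeomorphism_imp_homeomorphic_space)
  have 2: "top_of_set {x \<in> realization K. 0 < x v} homeomorphic_space top_of_set (ball (0::complex) 1)"
    using homeomorphism_imp_homeomorphic_space[OF gh] homeomorphic_space_sym by blast
  have "open (a ` ball 0 1)"
    using homeomorphism_imp_open_map[OF ab, of "ball 0 1"] by simp
  then show ?thesis by (rule that) (rule homeomorphic_space_trans[OF 2 1])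
qed

lemma compact_realization:
  fixes K :: "'a set set"
  assumes "finite_complex K"
  shows "compact (realization K)"
proof -
  \<comment> \<open>the closed simplex spanned by \<open>\<sigma>\<close>\<close>
  let ?C = "\<lambda>\<sigma>. {x :: 'a \<Rightarrow> real. (\<forall>v. 0 \<le> x v) \<and> (\<forall>v. v \<in> - \<sigma> \<longrightarrow> x v = 0) \<and> (\<Sum>v\<in>\<sigma>. x v) = 1}"
  have eq: "realization K = (\<Union>\<sigma>\<in>K. ?C \<sigma>)"
  proof (intro equalityI subsetI)
    fix x assume "x \<in> realization K"
    then show "x \<in> (\<Union>\<sigma>\<in>K. ?C \<sigma>)" by (auto simp: realization_def intro!: bexI[of _ "{v. x v \<noteq> 0}"])
  next
    fix x assume "x \<in> (\<Union>\<sigma>\<in>K. ?C \<sigma>)"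
    then obtain \<sigma> where \<sigma>: "\<sigma> \<in> K" "x \<in> ?C \<sigma>" by blast
    then have sub: "{v. x v \<noteq> 0} \<subseteq> \<sigma>" and fin: "finite \<sigma>"
      using assms finite_complex_finite by auto
    have "(\<Sum>v | x v \<noteq> 0. x v) = (\<Sum>v\<in>\<sigma>. x v)"
      using sub fin by (intro sum.mono_neutral_left) auto
    then have sum: "(\<Sum>v | x v \<noteq> 0. x v) = 1" using \<sigma> by simp
    then have "{v. x v \<noteq> 0} \<noteq> {}" by (metis sum.empty zero_neq_one)
    with assms \<sigma>(1) sub have "{v. x v \<noteq> 0} \<in> K" by (rule finite_complex_face)
    then show "x \<in> realization K" using \<sigma> sum by (simp add: realization_def)
  qed
  have cont: "continuous_on UNIV (\<lambda>x::'a \<Rightarrow> real. x v)" for v by simp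
  have "closed (?C \<sigma>)" for \<sigma>
  proof -
    have "closed {x :: 'a \<Rightarrow> real. \<forall>v. 0 \<le> x v}"
      by (intro closed_Collect_all closed_Collect_le cont continuous_on_const)
    moreover have "closed {x :: 'a \<Rightarrow> real. v \<in> - \<sigma> \<longrightarrow> x v = 0}" for v
      by (cases "v \<in> - \<sigma>") (simp_all add: closed_Collect_eq[OF cont continuous_on_const])
    then have "closed {x :: 'a \<Rightarrow> real. \<forall>v. v \<in> - \<sigma> \<longrightarrow> x v = 0}"
      by (rule closed_Collect_all)
    moreover have "closed {x :: 'a \<Rightarrow> real. (\<Sum>v\<in>\<sigma>. x v) = 1}"
      by (intro closed_Collect_eq continuous_on_sum cont continuous_on_const)
    ultimately show ?thesis by (intro closed_Collect_conj)
  qed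
  then have "closed (realization K)"
    unfolding eq using assms by (intro closed_UN) (auto simp: finite_complex_def)
  moreover have "compact (PiE UNIV (\<lambda>_::'a. {0..1::real}))"
    unfolding compactin_euclidean_iff[symmetric] euclidean_product_topology[symmetric] compactin_PiE
    by simp
  moreover have "realization K \<subseteq> PiE UNIV (\<lambda>_. {0..1})"
  proof
    fix x assume x: "x \<in> realization K"
    have "x v \<le> 1" for v
    proof (cases "x v = 0")
      case False
      have "finite {v. x v \<noteq> 0}" using x assms finite_complex_finite by (auto simp: realization_def)
      then have "x v \<le> (\<Sum>v | x v \<noteq> 0. x v)"
        using x False by (intro member_le_sum) (auto simp: realization_def)
      then show ?thesis using x by (simp add: realization_def)
    qed simp
    then show "x \<in> PiE UNIV (\<lambda>_. {0..1})" using x by (auto simp: realization_def)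
  qed
  ultimately show ?thesis using compact_Int_closed[of "PiE UNIV (\<lambda>_. {0..1})" "realization K"]
    by (simp add: Int_absorb1)
qed

lemma realization_star:
  assumes "x \<in> realization K"
  obtains v where "v \<in> vertices K" "0 < x v"
proof -
  have "(\<Sum>v | x v \<noteq> 0. x v) = 1" using assms by (simp add: realization_def)
  then have "{v. x v \<noteq> 0} \<noteq> {}" by (metis sum.empty zero_neq_one)
  then obtain v where "x v \<noteq> 0" by blast
  moreover have "v \<in> vertices K" using \<open>x v \<noteq> 0\<close> assms by (auto simp: realization_def)
  moreover have "0 < x v" using \<open>x v \<noteq> 0\<close> assms by (simp add: realization_def less_le)
  ultimately show ?thesis using that by blast
qed

lemma connected_realization:
  fixes K :: "'a::countable set set"
  assumes K: "finite_complex K"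
    and link: "\<And>v. v \<in> vertices K \<Longrightarrow> \<exists>f L. link_cycle K v f L"
    and conn: "\<And>u v. u \<in> vertices K \<Longrightarrow> v \<in> vertices K \<Longrightarrow> (u, v) \<in> {(a, b). {a, b} \<in> K}\<^sup>*"
  shows "connected (realization K)"
proof -
  let ?R = "realization K" and ?S = "\<lambda>v. {x \<in> realization K. 0 < x v}"
  have star: "connected (?S v)" if v: "v \<in> vertices K" for v
  proof -
    obtain f L where "link_cycle K v f L" using link v by blast
    then obtain g h where "homeomorphism (ball (0::complex) 1) (?S v) g h"
      using open_star_disk by blast
    then have "?S v homeomorphic ball (0::complex) 1"
      using homeomorphic_def homeomorphic_sym by blast
    then show ?thesis using homeomorphic_connectedness connected_ball by blast
  qed
  have same: "connected_component ?R x y" if "x \<in> ?S v" "y \<in> ?S v" "v \<in> vertices K" for x y v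
    unfolding connected_component_def using that star[OF that(3)] by (intro exI[of _ "?S v"]) auto
  have edge: "connected_component ?R x y" if "{u, v} \<in> K" "x \<in> ?S u" "y \<in> ?S v" for x y u v
  proof (cases "u = v")
    case True
    moreover have "u \<in> vertices K" using that(1) by auto
    ultimately show ?thesis using same[OF that(2)] that(3) by simp
  next
    case False
    \<comment> \<open>the midpoint of the edge lies in both open stars\<close>
    let ?z = "\<lambda>t. if t \<in> {u, v} then 1/2 else 0 :: real"
    have "{t. ?z t \<noteq> 0} = {u, v}" by auto
    then have "?z \<in> ?R" using that(1) False unfolding realization_def by auto
    then have z: "?z \<in> ?S u" "?z \<in> ?S v" by auto
    have "u \<in> vertices K" "v \<in> vertices K" using that(1) by auto
    then have "connected_component ?R x ?z" "connected_component ?R ?z y"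
      using same[OF that(2) z(1)] same[OF z(2) that(3)] by simp_all
    then show ?thesis by (rule connected_component_trans)
  qed
  have "connected_component ?R x y" if xy: "x \<in> ?R" "y \<in> ?R" for x y
  proof -
    obtain u where u: "u \<in> vertices K" "0 < x u" by (rule realization_star[OF xy(1)])
    obtain v where v: "v \<in> vertices K" "0 < y v" by (rule realization_star[OF xy(2)])
    have x: "x \<in> ?S u" and y: "y \<in> ?S v" using xy u v by simp_all
    have "(u, v) \<in> {(a, b). {a, b} \<in> K}\<^sup>*" using u(1) v(1) by (rule conn)
    then have "\<forall>y \<in> ?S v. connected_component ?R x y"
    proof induction
      case base
      show ?case using same[OF x _ u(1)] by (rule ballI)
    next
      case (step a b)
      have "{a} \<in> K" using finite_complex_face[OF K(1), of "{a, b}" "{a}"] step(2) by simp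
      then have e: "(\<lambda>t. if t = a then 1 else 0) \<in> ?S a"
        by (auto simp: realization_def Collect_conv_if)
      show ?case
      proof
        fix y assume y: "y \<in> ?S b"
        have "connected_component ?R x (\<lambda>t. if t = a then 1 else 0)" using step(3) e by (rule bspec)
        moreover have "connected_component ?R (\<lambda>t. if t = a then 1 else 0) y"
          using edge[OF _ e y] step(2) by simp
        ultimately show "connected_component ?R x y" by (rule connected_component_trans)
      qed
    qed
    then show ?thesis using y by (rule bspec)
  qed
  then show ?thesis by (simp add: connected_iff_connected_component)
qed

text \<open>
  The open stars of the vertices cover the space, since the coordinates of a point sum to 1, and each of them
  is a disk. Adjacent vertices have intersecting stars, which gives connectedness.
\<close>

theorem closed_surface_if_link_cycles:
  fixes K :: "'a::countable set set"
  assumes K: "finite_complex K" "K \<noteq> {}"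
    and link: "\<And>v. v \<in> vertices K \<Longrightarrow> \<exists>f L. link_cycle K v f L"
    and conn: "\<And>u v. u \<in> vertices K \<Longrightarrow> v \<in> vertices K \<Longrightarrow> (u, v) \<in> {(a, b). {a, b} \<in> K}\<^sup>*"
  shows "closed_surface (underlying_space K)"
  unfolding closed_surface_def
proof (intro conjI ballI)
  let ?X = "underlying_space K"
  have top: "topspace ?X = realization K" by (simp add: underlying_space_eq)
  obtain \<sigma> where \<sigma>: "\<sigma> \<in> K" "\<sigma> \<noteq> {}" using K by (auto simp: finite_complex_def)
  then obtain v where "v \<in> \<sigma>" by blast
  then have v: "{v} \<in> K" using finite_complex_face[OF K(1) \<sigma>(1), of "{v}"] by simp
  then have "(\<lambda>t. if t = v then 1 else 0) \<in> realization K"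
    by (auto simp: realization_def Collect_conv_if)
  then show "topspace ?X \<noteq> {}" using top by auto
  show "Hausdorff_space ?X"
    unfolding underlying_space_eq by (intro Hausdorff_space_subtopology) simp
  have "second_countable (euclidean :: ('a \<Rightarrow> real) topology)"
  proof -
    obtain \<B> :: "('a \<Rightarrow> real) set set" where \<B>: "countable \<B>" "topological_basis \<B>"
      using ex_countable_basis by metis
    have "\<forall>V\<in>\<B>. openin euclidean V" using topological_basis_open[OF \<B>(2)] open_openin by blast
    moreover have "\<exists>V\<in>\<B>. x \<in> V \<and> V \<subseteq> U" if "openin euclidean U \<and> x \<in> U" for U and x :: "'a \<Rightarrow> real"
    proof -
      have "open U" "x \<in> U" using that open_openin by blast+
      then show ?thesis using topological_basisE[OF \<B>(2)] by metis
    qed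
    ultimately show ?thesis unfolding second_countable_def using \<B>(1) by blast
  qed
  then show "second_countable ?X"
    unfolding underlying_space_eq by (rule second_countable_subtopology)
  show "compact_space ?X"
    unfolding underlying_space_eq
    using compact_realization[OF K(1)] by (intro compact_space_subtopology) simp
  show "connected_space ?X"
    unfolding underlying_space_eq using connected_realization[OF K(1) link conn]
    by (intro connected_space_subtopology) simp
  fix x assume "x \<in> topspace ?X"
  then have x: "x \<in> realization K" by (simp add: top)
  then obtain v where v: "v \<in> vertices K" "0 < x v" by (rule realization_star)
  obtain f L where "link_cycle K v f L" using link v(1) by blast
  then obtain W :: "(real^2) set" where W: "open W"
    "top_of_set {x \<in> realization K. 0 < x v} homeomorphic_space top_of_set W"
    by (rule star_plane)
  let ?U = "realization K \<inter> {x. 0 < x v}"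
  have "open {x :: 'a \<Rightarrow> real. 0 < x v}" by (intro open_Collect_less) auto
  then have "openin ?X ?U" unfolding underlying_space_eq by (intro openin_open_Int)
  moreover have "subtopology ?X ?U = top_of_set {x \<in> realization K. 0 < x v}"
    unfolding underlying_space_eq subtopology_subtopology by (simp add: Int_def)
  ultimately show "\<exists>U W. openin ?X U \<and> x \<in> U \<and> open (W :: (real^2) set) \<and>
      subtopology ?X U homeomorphic_space top_of_set W"
    using x v W by (intro exI[of _ ?U] exI[of _ W]) auto
qed

section \<open>The underlying space after stacking\<close>

lemma finite_triangles: "finite_complex K \<Longrightarrow> finite (triangles K)"
  by (simp add: finite_complex_def triangles_def)

lemma stack_all_cases:
  assumes "\<rho> \<in> stack_all K"
  obtains (old) \<tau> where "\<rho> = Inl ` \<tau>" "\<tau> \<in> K" "card \<tau> \<noteq> 3"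
    | (new) \<sigma> \<tau> where "\<rho> = insert (Inr \<sigma>) (Inl ` \<tau>)" "\<sigma> \<in> K" "card \<sigma> = 3" "\<tau> \<subset> \<sigma>"
  using assms unfolding stack_all_def triangles_def by blast

lemma stack_all_old: "\<tau> \<in> K \<Longrightarrow> card \<tau> \<noteq> 3 \<Longrightarrow> Inl ` \<tau> \<in> stack_all K"
  unfolding stack_all_def triangles_def by blast

lemma stack_all_new: "\<sigma> \<in> K \<Longrightarrow> card \<sigma> = 3 \<Longrightarrow> \<tau> \<subset> \<sigma> \<Longrightarrow> insert (Inr \<sigma>) (Inl ` \<tau>) \<in> stack_all K"
  unfolding stack_all_def triangles_def by blast

lemma finite_complex_stack_all:
  assumes K: "finite_complex K" and dim: "\<And>\<sigma>. \<sigma> \<in> K \<Longrightarrow> card \<sigma> \<le> 3"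
  shows "finite_complex (stack_all K)"
  unfolding finite_complex_def
proof (intro conjI ballI allI impI)
  have "stack_all K \<subseteq> (`) Inl ` K \<union> (\<Union>\<sigma>\<in>triangles K. (\<lambda>\<tau>. insert (Inr \<sigma>) (Inl ` \<tau>)) ` Pow \<sigma>)"
    unfolding stack_all_def by blast
  moreover have "finite ((`) Inl ` K \<union> (\<Union>\<sigma>\<in>triangles K. (\<lambda>\<tau>. insert (Inr \<sigma>) (Inl ` \<tau>)) ` Pow \<sigma>))"
    using K finite_triangles[OF K] finite_complex_finite[OF K] by (auto simp: finite_complex_def triangles_def)
  ultimately show "finite (stack_all K)" by (rule finite_subset)
next
  fix \<rho> assume "\<rho> \<in> stack_all K"
  then show "finite \<rho>"
  proof (cases rule: stack_all_cases)
    case (old \<tau>) then show ?thesis using finite_complex_finite[OF K] by simp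
  next
    case (new \<sigma> \<tau>)
    then have "finite \<tau>" using finite_complex_finite[OF K new(2)] finite_subset[of \<tau> \<sigma>] by blast
    then show ?thesis using new by simp
  qed
next
  fix \<rho> assume "\<rho> \<in> stack_all K"
  then show "\<rho> \<noteq> {}" using K by (cases rule: stack_all_cases) (auto simp: finite_complex_def)
next
  fix \<rho> \<rho>' assume "\<rho> \<in> stack_all K" and \<rho>': "\<rho>' \<noteq> {} \<and> \<rho>' \<subseteq> \<rho>"
  then show "\<rho>' \<in> stack_all K"
  proof (cases rule: stack_all_cases)
    case (old \<tau>)
    then obtain \<tau>' where \<tau>': "\<tau>' \<subseteq> \<tau>" "\<rho>' = Inl ` \<tau>'" using \<rho>' subset_imageE by metis
    have "card \<tau>' < 3"
      using card_mono[OF finite_complex_finite[OF K old(2)] \<tau>'(1)] dim[OF old(2)] old(3) by simp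
    moreover have "\<tau>' \<in> K" using finite_complex_face[OF K old(2) \<tau>'(1)] \<rho>' \<tau>'(2) by simp
    ultimately show ?thesis using \<tau>'(2) stack_all_old[of \<tau>' K] by simp
  next
    case (new \<sigma> \<tau>)
    have "\<rho>' - {Inr \<sigma>} \<subseteq> Inl ` \<tau>" using \<rho>' new(1) by blast
    then obtain \<tau>' where \<tau>': "\<tau>' \<subseteq> \<tau>" "\<rho>' - {Inr \<sigma>} = Inl ` \<tau>'" using subset_imageE by metis
    show ?thesis
    proof (cases "Inr \<sigma> \<in> \<rho>'")
      case True
      then have "\<rho>' = insert (Inr \<sigma>) (Inl ` \<tau>')" using \<tau>'(2) by blast
      then show ?thesis using stack_all_new[OF new(2,3), of \<tau>'] \<tau>'(1) new(4) by auto
    next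
      case False
      then have eq: "\<rho>' = Inl ` \<tau>'" using \<tau>'(2) by blast
      have "\<tau>' \<subset> \<sigma>" using \<tau>'(1) new(4) by blast
      then have "card \<tau>' < 3" using psubset_card_mono[OF finite_complex_finite[OF K new(2)]] new(3) by metis
      moreover have "\<tau>' \<in> K" using finite_complex_face[OF K new(2), of \<tau>'] \<open>\<tau>' \<subset> \<sigma>\<close> \<rho>' eq by auto
      ultimately show ?thesis using eq stack_all_old[of \<tau>' K] by simp
    qed
  qed
qed

text \<open>
  The natural map from the stacked complex to the original one, affine on every simplex, that sends the apex
  of the cone over \<open>\<sigma>\<close> to the barycenter of \<open>\<sigma>\<close>.
\<close>

definition stack_map :: "'a set set \<Rightarrow> ('a + 'a set \<Rightarrow> real) \<Rightarrow> 'a \<Rightarrow> real" where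
  "stack_map K x = (\<lambda>v. x (Inl v) + (\<Sum>\<sigma> | \<sigma> \<in> triangles K \<and> v \<in> \<sigma>. x (Inr \<sigma>)) / 3)"

text \<open>
  The point with coordinates \<open>y\<close> at the old vertices and coordinate \<open>t\<close> at the new vertex \<open>Inr \<sigma>\<close>. With \<open>t = 0\<close>
  the choice of \<open>\<sigma>\<close> does not matter.
\<close>

definition stack_point :: "('a \<Rightarrow> real) \<Rightarrow> 'a set \<Rightarrow> real \<Rightarrow> 'a + 'a set \<Rightarrow> real" where
  "stack_point y \<sigma> t = case_sum y (\<lambda>\<rho>. if \<rho> = \<sigma> then t else 0)"

lemma supp_stack_point:
  "{u. stack_point y \<sigma> t u \<noteq> 0} = (if t = 0 then {} else {Inr \<sigma>}) \<union> Inl ` {v. y v \<noteq> 0}"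
proof -
  have "u \<in> {u. stack_point y \<sigma> t u \<noteq> 0} \<longleftrightarrow> u \<in> (if t = 0 then {} else {Inr \<sigma>}) \<union> Inl ` {v. y v \<noteq> 0}" for u
    by (cases u) (auto simp: stack_point_def)
  then show ?thesis by blast
qed

lemma sum_stack_point:
  assumes "finite {v. y v \<noteq> 0}"
  shows "(\<Sum>u | stack_point y \<sigma> t u \<noteq> 0. stack_point y \<sigma> t u) = t + (\<Sum>v | y v \<noteq> 0. y v)"
proof -
  have "(\<Sum>u\<in>Inl ` {v. y v \<noteq> 0}. stack_point y \<sigma> t u) = (\<Sum>v | y v \<noteq> 0. y v)"
    by (simp add: sum.reindex stack_point_def)
  moreover have "Inr \<sigma> \<notin> Inl ` {v. y v \<noteq> 0}" by blast
  ultimately show ?thesis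
    using assms unfolding supp_stack_point by (auto simp: stack_point_def)
qed

lemma stack_map_stack_point:
  assumes "finite_complex K" "t = 0 \<or> \<sigma> \<in> triangles K"
  shows "stack_map K (stack_point y \<sigma> t) = (\<lambda>v. y v + (if v \<in> \<sigma> then t / 3 else 0))"
proof
  fix v
  have "finite {\<rho> \<in> triangles K. v \<in> \<rho>}" using finite_triangles[OF assms(1)] by simp
  then have "(\<Sum>\<rho> | \<rho> \<in> triangles K \<and> v \<in> \<rho>. if \<rho> = \<sigma> then t else 0) = (if \<sigma> \<in> triangles K \<and> v \<in> \<sigma> then t else 0)"
    by (simp add: sum.delta)
  then show "stack_map K (stack_point y \<sigma> t) v = y v + (if v \<in> \<sigma> then t / 3 else 0)"
    using assms(2) by (auto simp: stack_map_def stack_point_def)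
qed

text \<open>
  A point of the stacked complex lies in an old face that is not a triangle or, with a positive weight \<open>t\<close> at the
  apex, in exactly one of the cones.
\<close>

lemma realization_stack_all:
  fixes K :: "'a set set"
  assumes K: "finite_complex K"
  shows "realization (stack_all K) =
      {stack_point y {} 0 | y. y \<in> realization K \<and> card {v. y v \<noteq> 0} \<noteq> 3} \<union>
      {stack_point y \<sigma> t | y \<sigma> t. \<sigma> \<in> triangles K \<and> 0 < t \<and> (\<forall>v. 0 \<le> y v) \<and> {v. y v \<noteq> 0} \<subset> \<sigma> \<and>
         t + (\<Sum>v | y v \<noteq> 0. y v) = 1}" (is "_ = ?A \<union> ?B")
proof (intro equalityI subsetI)
  fix x assume "x \<in> realization (stack_all K)"
  then have nn: "\<And>u. 0 \<le> x u" and supp: "{u. x u \<noteq> 0} \<in> stack_all K" and sum: "(\<Sum>u | x u \<noteq> 0. x u) = 1"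
    by (auto simp: realization_def)
  define y where "y v = x (Inl v)" for v
  from supp show "x \<in> ?A \<union> ?B"
  proof (cases rule: stack_all_cases)
    case (old \<tau>)
    have x: "x = stack_point y {} 0"
    proof
      fix u show "x u = stack_point y {} 0 u"
        using old(1) by (cases u) (auto simp: stack_point_def y_def)
    qed
    have \<tau>: "{v. y v \<noteq> 0} = \<tau>" using old(1) by (auto simp: y_def)
    then have "finite {v. y v \<noteq> 0}" using finite_complex_finite[OF K old(2)] by simp
    from sum_stack_point[OF this, of "{}" 0] have "(\<Sum>v | y v \<noteq> 0. y v) = 1"
      using sum x by simp
    then have "y \<in> realization K" using nn \<tau> old(2) by (simp add: realization_def y_def)
    then show ?thesis using x \<tau> old(3) by blast
  next
    case (new \<sigma> \<tau>)
    define t where "t = x (Inr \<sigma>)"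
    have x: "x = stack_point y \<sigma> t"
    proof
      fix u show "x u = stack_point y \<sigma> t u"
        using new(1) by (cases u) (auto simp: stack_point_def y_def t_def)
    qed
    have "x (Inr \<sigma>) \<noteq> 0" using new(1) by blast
    then have t: "0 < t" using nn[of "Inr \<sigma>"] by (simp add: t_def)
    have \<tau>: "{v. y v \<noteq> 0} = \<tau>" using new(1) by (auto simp: y_def)
    then have "finite {v. y v \<noteq> 0}" using finite_complex_finite[OF K new(2)] new(4) by (meson finite_subset psubset_imp_subset)
    from sum_stack_point[OF this, of \<sigma> t] have "t + (\<Sum>v | y v \<noteq> 0. y v) = 1"
      using sum x by simp
    moreover have "\<forall>v. 0 \<le> y v" using nn by (simp add: y_def)
    moreover have "\<sigma> \<in> triangles K" using new by (simp add: triangles_def)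
    ultimately have "x \<in> ?B" using x \<tau> t new(4) by blast
    then show ?thesis ..
  qed
next
  fix x assume "x \<in> ?A \<union> ?B"
  then show "x \<in> realization (stack_all K)"
  proof
    assume "x \<in> ?A"
    then obtain y where y: "x = stack_point y {} 0" "y \<in> realization K" "card {v. y v \<noteq> 0} \<noteq> 3" by blast
    then have "{v. y v \<noteq> 0} \<in> K" by (simp add: realization_def)
    then have "{u. x u \<noteq> 0} \<in> stack_all K" "finite {v. y v \<noteq> 0}"
      unfolding y(1) supp_stack_point using stack_all_old y(3) finite_complex_finite[OF K] by auto
    moreover from sum_stack_point[OF this(2), of "{}" 0] have "(\<Sum>u | x u \<noteq> 0. x u) = 1"
      using y(2) unfolding y(1) by (simp add: realization_def)
    moreover have "0 \<le> x u" for u using y by (cases u) (auto simp: stack_point_def realization_def)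
    ultimately show ?thesis by (simp add: realization_def)
  next
    assume "x \<in> ?B"
    then obtain y \<sigma> t where y: "x = stack_point y \<sigma> t" "\<sigma> \<in> triangles K" "0 < t" "\<forall>v. 0 \<le> y v"
      "{v. y v \<noteq> 0} \<subset> \<sigma>" "t + (\<Sum>v | y v \<noteq> 0. y v) = 1" by blast
    have \<sigma>: "\<sigma> \<in> K" "card \<sigma> = 3" using y(2) by (auto simp: triangles_def)
    have "finite {v. y v \<noteq> 0}" using y(5) finite_complex_finite[OF K \<sigma>(1)] by (meson finite_subset psubset_imp_subset)
    from sum_stack_point[OF this, of \<sigma> t] have "(\<Sum>u | x u \<noteq> 0. x u) = 1" using y by simp
    moreover have "{u. x u \<noteq> 0} \<in> stack_all K"
      unfolding y(1) supp_stack_point using stack_all_new[OF \<sigma> y(5)] y(3) by simp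
    moreover have "0 \<le> x u" for u using y by (cases u) (auto simp: stack_point_def)
    ultimately show ?thesis by (simp add: realization_def)
  qed
qed

lemma stack_map_image:
  fixes K :: "'a set set"
  assumes K: "finite_complex K"
  shows "stack_map K ` realization (stack_all K) = realization K"
proof (intro equalityI subsetI)
  fix z assume "z \<in> stack_map K ` realization (stack_all K)"
  then obtain x where x: "x \<in> realization (stack_all K)" "z = stack_map K x" by blast
  from x(1) show "z \<in> realization K" unfolding realization_stack_all[OF K]
  proof
    assume "x \<in> {stack_point y {} 0 | y. y \<in> realization K \<and> card {v. y v \<noteq> 0} \<noteq> 3}"
    then obtain y where y: "x = stack_point y {} 0" "y \<in> realization K" by blast
    then have "z = y" using x(2) stack_map_stack_point[OF K, of 0 "{}" y] by simp
    then show ?thesis using y by simp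
  next
    assume "x \<in> {stack_point y \<sigma> t | y \<sigma> t. \<sigma> \<in> triangles K \<and> 0 < t \<and> (\<forall>v. 0 \<le> y v) \<and>
      {v. y v \<noteq> 0} \<subset> \<sigma> \<and> t + (\<Sum>v | y v \<noteq> 0. y v) = 1}"
    then obtain y \<sigma> t where y: "x = stack_point y \<sigma> t" "\<sigma> \<in> triangles K" "0 < t" "\<forall>v. 0 \<le> y v"
      "{v. y v \<noteq> 0} \<subset> \<sigma>" "t + (\<Sum>v | y v \<noteq> 0. y v) = 1" by blast
    have \<sigma>: "\<sigma> \<in> K" "card \<sigma> = 3" using y(2) by (auto simp: triangles_def)
    have fin: "finite \<sigma>" using finite_complex_finite[OF K \<sigma>(1)] .
    have z: "z = (\<lambda>v. y v + (if v \<in> \<sigma> then t / 3 else 0))"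
      using x(2) y(1) stack_map_stack_point[OF K disjI2[OF y(2)]] by simp
    have "y v + t / 3 \<noteq> 0" for v using y(3) y(4)[rule_format, of v] by linarith
    then have "{v. z v \<noteq> 0} = \<sigma>" using y(5) by (auto simp: z)
    moreover have "(\<Sum>v\<in>\<sigma>. z v) = 1"
    proof -
      have "(\<Sum>v\<in>\<sigma>. z v) = (\<Sum>v\<in>\<sigma>. y v) + t"
        using \<sigma>(2) by (simp add: z sum.distrib)
      also have "(\<Sum>v\<in>\<sigma>. y v) = (\<Sum>v | y v \<noteq> 0. y v)"
        using y(5) fin by (intro sum.mono_neutral_right) auto
      finally show ?thesis using y(6) by simp
    qed
    moreover have "0 \<le> z v" for v using y(3,4) by (simp add: z)
    ultimately show ?thesis using \<sigma>(1) by (simp add: realization_def)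
  qed
next
  fix z assume z: "z \<in> realization K"
  show "z \<in> stack_map K ` realization (stack_all K)"
  proof (cases "card {v. z v \<noteq> 0} = 3")
    case False
    then have "stack_point z {} 0 \<in> realization (stack_all K)"
      unfolding realization_stack_all[OF K] using z by blast
    moreover have "stack_map K (stack_point z {} 0) = z"
      using stack_map_stack_point[OF K, of 0 "{}" z] by simp
    ultimately show ?thesis by (metis imageI)
  next
    case True
    define \<sigma> where "\<sigma> = {v. z v \<noteq> 0}"
    have \<sigma>: "\<sigma> \<in> triangles K" using True z by (simp add: \<sigma>_def triangles_def realization_def)
    have fin: "finite \<sigma>" using True by (metis \<sigma>_def card.infinite zero_neq_numeral)
    have ne: "\<sigma> \<noteq> {}" using True by (metis \<sigma>_def card.empty zero_neq_numeral)
    have card: "card \<sigma> = 3" using True by (simp add: \<sigma>_def)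
    \<comment> \<open>after subtraction of the least coordinate, the remaining weights are supported on a proper face\<close>
    define s where "s = Min (z ` \<sigma>)"
    have "s \<in> z ` \<sigma>" unfolding s_def using fin ne by (intro Min_in) auto
    then obtain u where u: "u \<in> \<sigma>" "z u = s" by auto
    have le: "s \<le> z v" if "v \<in> \<sigma>" for v using fin that by (simp add: s_def)
    have s: "0 < s" using u z by (auto simp: \<sigma>_def realization_def less_le)
    define y where "y v = (if v \<in> \<sigma> then z v - s else 0)" for v
    have nn: "\<forall>v. 0 \<le> y v" using le by (simp add: y_def)
    have "u \<notin> {v. y v \<noteq> 0}" using u by (simp add: y_def)
    moreover have "{v. y v \<noteq> 0} \<subseteq> \<sigma>" by (auto simp: y_def)
    ultimately have sub: "{v. y v \<noteq> 0} \<subset> \<sigma>" using u(1) by blast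
    have "(\<Sum>v | y v \<noteq> 0. y v) = (\<Sum>v\<in>\<sigma>. y v)"
      using sub fin by (intro sum.mono_neutral_left) auto
    also have "\<dots> = (\<Sum>v\<in>\<sigma>. z v) - 3 * s" using card by (simp add: y_def sum_subtractf)
    also have "(\<Sum>v\<in>\<sigma>. z v) = 1" using z by (simp add: \<sigma>_def realization_def)
    finally have "3 * s + (\<Sum>v | y v \<noteq> 0. y v) = 1" by simp
    moreover have "0 < 3 * s" using s by simp
    ultimately have "stack_point y \<sigma> (3 * s) \<in> realization (stack_all K)"
      unfolding realization_stack_all[OF K] using \<sigma> nn sub by blast
    moreover have "stack_map K (stack_point y \<sigma> (3 * s)) = z"
      using stack_map_stack_point[OF K disjI2[OF \<sigma>]] by (auto simp: y_def \<sigma>_def)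
    ultimately show ?thesis by (metis imageI)
  qed
qed

text \<open>
  The inverse of \<^const>\<open>stack_map\<close>. In the interior of a triangle \<open>\<sigma>\<close> with least coordinate \<open>s\<close>, the new vertex
  gets the weight \<open>3 * s\<close>, since the barycenter contributes a third of this weight to each vertex of \<open>\<sigma>\<close>.
\<close>

definition stack_inverse :: "('a \<Rightarrow> real) \<Rightarrow> 'a + 'a set \<Rightarrow> real" where
  "stack_inverse z =
    (let \<sigma> = {v. z v \<noteq> 0}; s = Min (z ` \<sigma>) in
     if card \<sigma> = 3 then stack_point (\<lambda>v. if v \<in> \<sigma> then z v - s else 0) \<sigma> (3 * s)
     else stack_point z {} 0)"

lemma stack_inverse_stack_map:
  assumes K: "finite_complex K" and x: "x \<in> realization (stack_all K)"
  shows "stack_inverse (stack_map K x) = x"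
  using x unfolding realization_stack_all[OF K]
proof
  assume "x \<in> {stack_point y {} 0 | y. y \<in> realization K \<and> card {v. y v \<noteq> 0} \<noteq> 3}"
  then obtain y where y: "x = stack_point y {} 0" "card {v. y v \<noteq> 0} \<noteq> 3" by blast
  moreover have "stack_map K (stack_point y {} 0) = y" using stack_map_stack_point[OF K, of 0 "{}" y] by simp
  ultimately show ?thesis by (simp add: stack_inverse_def Let_def)
next
  assume "x \<in> {stack_point y \<sigma> t | y \<sigma> t. \<sigma> \<in> triangles K \<and> 0 < t \<and> (\<forall>v. 0 \<le> y v) \<and>
      {v. y v \<noteq> 0} \<subset> \<sigma> \<and> t + (\<Sum>v | y v \<noteq> 0. y v) = 1}"
  then obtain y \<sigma> t where y: "x = stack_point y \<sigma> t" "\<sigma> \<in> triangles K" "0 < t" "\<forall>v. 0 \<le> y v"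
      "{v. y v \<noteq> 0} \<subset> \<sigma>" by blast
  have \<sigma>: "\<sigma> \<in> K" "card \<sigma> = 3" using y(2) by (auto simp: triangles_def)
  have fin: "finite \<sigma>" using finite_complex_finite[OF K \<sigma>(1)] .
  define z where "z = stack_map K x"
  then have z: "z = (\<lambda>v. y v + (if v \<in> \<sigma> then t / 3 else 0))"
    using y(1) stack_map_stack_point[OF K disjI2[OF y(2)]] by simp
  have "y v + t / 3 \<noteq> 0" for v using y(3) y(4)[rule_format, of v] by linarith
  then have supp: "{v. z v \<noteq> 0} = \<sigma>" using y(5) by (auto simp: z)
  obtain u where u: "u \<in> \<sigma>" "y u = 0" using y(5) by blast
  have min: "Min (z ` \<sigma>) = t / 3"
  proof (rule Min_eqI)
    show "finite (z ` \<sigma>)" using fin by simp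
    show "t / 3 \<le> r" if "r \<in> z ` \<sigma>" for r using that y(4) by (auto simp: z)
    show "t / 3 \<in> z ` \<sigma>" using u by (auto simp: z intro!: rev_image_eqI[of u])
  qed
  have yz: "y = (\<lambda>v. if v \<in> \<sigma> then z v - t / 3 else 0)"
  proof
    fix v show "y v = (if v \<in> \<sigma> then z v - t / 3 else 0)"
      using y(5) by (cases "v \<in> \<sigma>") (auto simp: z)
  qed
  have "stack_inverse z = stack_point (\<lambda>v. if v \<in> \<sigma> then z v - t / 3 else 0) \<sigma> t"
    using \<sigma>(2) by (simp only: stack_inverse_def Let_def supp min) simp
  also have "\<dots> = x" by (simp only: yz[symmetric] y(1))
  finally show ?thesis by (simp only: z_def)
qed

lemma inj_on_stack_map:
  assumes K: "finite_complex K"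
  shows "inj_on (stack_map K) (realization (stack_all K))"
  by (intro inj_on_inverseI[where g = stack_inverse] stack_inverse_stack_map[OF K])

text \<open>
  A continuous bijection from a compact space to a Hausdorff space is a homeomorphism.
\<close>

theorem stack_all_homeomorphic:
  fixes K :: "'a::countable set set"
  assumes K: "finite_complex K" and dim: "\<And>\<sigma>. \<sigma> \<in> K \<Longrightarrow> card \<sigma> \<le> 3"
  shows "underlying_space (stack_all K) homeomorphic_space underlying_space K"
proof -
  have coord: "continuous_on S (\<lambda>x :: 'a + 'a set \<Rightarrow> real. x u)" for u and S
    by (rule continuous_on_subset[OF continuous_on_product_coordinates]) simp
  have "continuous_on (realization (stack_all K)) (stack_map K)"
    unfolding stack_map_def
  proof (rule continuous_on_coordinatewise_then_product)
    fix v
    show "continuous_on (realization (stack_all K))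
        (\<lambda>x. x (Inl v) + (\<Sum>\<sigma> | \<sigma> \<in> triangles K \<and> v \<in> \<sigma>. x (Inr \<sigma>)) / 3)"
      by (rule continuous_on_add[OF coord continuous_on_divide[OF continuous_on_sum[OF coord] continuous_on_const]]) simp
  qed
  then have "continuous_map (underlying_space (stack_all K)) (underlying_space K) (stack_map K)"
    using stack_map_image[OF K] by (auto simp: underlying_space_eq continuous_map_in_subtopology)
  moreover have "compact_space (underlying_space (stack_all K))"
    unfolding underlying_space_eq using compact_realization[OF finite_complex_stack_all[OF K dim]]
    by (intro compact_space_subtopology) simp
  moreover have "Hausdorff_space (underlying_space K)"
    unfolding underlying_space_eq by (intro Hausdorff_space_subtopology) simp
  ultimately have "homeomorphic_map (underlying_space (stack_all K)) (underlying_space K) (stack_map K)"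
    using inj_on_stack_map[OF K] stack_map_image[OF K]
    by (intro continuous_imp_homeomorphic_map) (simp_all add: underlying_space_eq)
  then show ?thesis by (rule homeomorphic_map_imp_homeomorphic_space)
qed

section \<open>Euler characteristic, degrees and orientation after stacking\<close>

lemma sum_proper_subsets_of_triangle:
  assumes "card \<sigma> = 3"
  shows "(\<Sum>\<tau> | \<tau> \<subset> \<sigma>. (-1::int) ^ card \<tau>) = 1"
proof -
  have fin: "finite \<sigma>" and ne: "\<sigma> \<noteq> {}" using assms by (auto intro: card_ge_0_finite)
  have "(\<Sum>\<tau>\<in>Pow \<sigma>. (-1::int) ^ card \<tau>) = (\<Prod>x\<in>\<sigma>. 1 - 1)"
    using prod_diff_conv_sum[OF fin, of "\<lambda>_. 1::int" "\<lambda>_. 1"] by simp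
  also have "\<dots> = 0" using fin ne by (simp add: card_gt_0_iff)
  finally have "(\<Sum>\<tau>\<in>Pow \<sigma>. (-1::int) ^ card \<tau>) = 0" .
  moreover have "{\<tau>. \<tau> \<subset> \<sigma>} = Pow \<sigma> - {\<sigma>}" by blast
  ultimately show ?thesis using fin assms by (simp add: sum_diff1)
qed

text \<open>
  Removing a triangle \<open>\<sigma>\<close> removes 1 from the alternating sum. The cells added in its place are the joins of the
  new vertex with the proper subsets of \<open>\<sigma>\<close>; their alternating sum is also 1.
\<close>

lemma euler_char_stack_all:
  fixes K :: "'a set set"
  assumes K: "finite_complex K"
  shows "euler_char (stack_all K) = euler_char K"
proof -
  let ?T = "triangles K" and ?f = "\<lambda>\<sigma>. (-1::int) ^ (card \<sigma> - 1)" and ?g = "\<lambda>\<sigma>. (-1::int) ^ (card \<sigma> - 1)"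
  let ?A = "((`) Inl ` (K - ?T)) :: ('a + 'a set) set set"
  let ?cone = "\<lambda>(\<sigma>, \<tau>). insert (Inr \<sigma>) (Inl ` \<tau>) :: ('a + 'a set) set"
  let ?S = "Sigma ?T (\<lambda>\<sigma>. {\<tau>. \<tau> \<subset> \<sigma>})"
  have fin: "finite \<sigma>" if "\<sigma> \<in> K" for \<sigma> using K that by (rule finite_complex_finite)
  have finK: "finite K" using K by (simp add: finite_complex_def)
  have finT: "finite ?T" using K by (rule finite_triangles)
  have sub: "finite {\<tau>. \<tau> \<subset> \<sigma>}" if "\<sigma> \<in> ?T" for \<sigma>
    using fin[of \<sigma>] that by (auto simp: triangles_def intro: finite_subset[of _ "Pow \<sigma>"])
  have stack: "stack_all K = ?A \<union> ?cone ` ?S"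
    unfolding stack_all_def by auto
  have disj: "?A \<inter> ?cone ` ?S = {}" by auto
  have injA: "inj_on ((`) Inl :: 'a set \<Rightarrow> ('a + 'a set) set) (K - ?T)"
    by (intro inj_onI) (simp add: inj_image_eq_iff)
  have injS: "inj_on ?cone ?S"
  proof (rule inj_onI)
    fix p q assume eq: "?cone p = ?cone q"
    obtain \<sigma> \<tau> \<sigma>' \<tau>' where pq: "p = (\<sigma>, \<tau>)" "q = (\<sigma>', \<tau>')" by (cases p; cases q)
    then have eq: "insert (Inr \<sigma>) (Inl ` \<tau>) = insert (Inr \<sigma>') (Inl ` \<tau>')" using eq by simp
    then have "\<sigma> = \<sigma>'" "\<tau> = \<tau>'" by blast+
    then show "p = q" using pq by simp
  qed
  have "euler_char (stack_all K) = (\<Sum>\<rho>\<in>?A. ?f \<rho>) + (\<Sum>\<rho>\<in>?cone ` ?S. ?f \<rho>)"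
    unfolding euler_char_def stack using disj finK finT sub by (intro sum.union_disjoint) auto
  also have "(\<Sum>\<rho>\<in>?A. ?f \<rho>) = (\<Sum>\<sigma>\<in>K - ?T. ?g \<sigma>)"
    by (simp add: sum.reindex[OF injA] card_image)
  also have "(\<Sum>\<rho>\<in>?cone ` ?S. ?f \<rho>) = (\<Sum>p\<in>?S. ?f (?cone p))"
    by (simp add: sum.reindex[OF injS])
  also have "\<dots> = (\<Sum>p\<in>?S. (\<lambda>(\<sigma>, \<tau>). (-1) ^ card \<tau>) p)"
  proof (rule sum.cong)
    fix p assume p: "p \<in> ?S"
    obtain \<sigma> \<tau> where "p = (\<sigma>, \<tau>)" by (cases p)
    moreover from this have "finite \<tau>" using p fin[of \<sigma>] by (auto simp: triangles_def intro: finite_subset)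
    moreover have "Inr \<sigma> \<notin> Inl ` \<tau>" by blast
    ultimately show "?f (?cone p) = (\<lambda>(\<sigma>, \<tau>). (-1) ^ card \<tau>) p" by (simp add: card_image)
  qed simp
  also have "\<dots> = (\<Sum>\<sigma>\<in>?T. \<Sum>\<tau> | \<tau> \<subset> \<sigma>. (-1) ^ card \<tau>)"
    using finT sub by (intro sum.Sigma[symmetric]) auto
  also have "\<dots> = (\<Sum>\<sigma>\<in>?T. 1)"
    by (intro sum.cong sum_proper_subsets_of_triangle) (auto simp: triangles_def)
  also have "\<dots> = (\<Sum>\<sigma>\<in>?T. ?g \<sigma>)"
    by (intro sum.cong) (auto simp: triangles_def)
  also have "(\<Sum>\<sigma>\<in>K - ?T. ?g \<sigma>) + (\<Sum>\<sigma>\<in>?T. ?g \<sigma>) = euler_char K"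
    unfolding euler_char_def using finK
    by (subst sum.subset_diff[of ?T K]) (auto simp: triangles_def)
  finally show ?thesis .
qed

lemma triangles_stack_all:
  "triangles (stack_all K) = {{Inl a, Inl b, Inr \<sigma>} | a b \<sigma>. \<sigma> \<in> triangles K \<and> a \<in> \<sigma> \<and> b \<in> \<sigma> \<and> a \<noteq> b}"
    (is "?L = ?R")
proof (intro equalityI subsetI)
  fix \<rho> assume "\<rho> \<in> ?L"
  then have "\<rho> \<in> stack_all K" and card: "card \<rho> = 3" by (auto simp: triangles_def)
  from this(1) show "\<rho> \<in> ?R"
  proof (cases rule: stack_all_cases)
    case (old \<tau>) then show ?thesis using card by (simp add: card_image)
  next
    case (new \<sigma> \<tau>)
    have "finite \<sigma>" using new(3) by (metis card.infinite zero_neq_numeral)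
    then have "finite \<tau>" using new(4) by (meson finite_subset psubset_imp_subset)
    moreover have "Inr \<sigma> \<notin> Inl ` \<tau>" by blast
    ultimately have "card \<tau> = 2" using card new(1) by (simp add: card_image)
    then obtain a b where ab: "\<tau> = {a, b}" "a \<noteq> b" by (meson card_2_iff)
    then have "\<rho> = {Inl a, Inl b, Inr \<sigma>}" "a \<in> \<sigma>" "b \<in> \<sigma>" using new(1,4) by auto
    then show ?thesis using ab(2) new(2,3) by (auto simp: triangles_def)
  qed
next
  fix \<rho> assume "\<rho> \<in> ?R"
  then obtain a b \<sigma> where \<rho>: "\<rho> = {Inl a, Inl b, Inr \<sigma>}" "\<sigma> \<in> K" "card \<sigma> = 3" "a \<in> \<sigma>" "b \<in> \<sigma>" "a \<noteq> b"
    by (auto simp: triangles_def)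
  have "card {a, b} \<noteq> card \<sigma>" using \<rho>(3,6) by simp
  then have "{a, b} \<subset> \<sigma>" using \<rho>(4,5) by blast
  from stack_all_new[OF \<rho>(2,3) this] have "\<rho> \<in> stack_all K"
    using \<rho>(1) by (simp add: insert_commute)
  moreover have "card \<rho> = 3" using \<rho>(1,6) by simp
  ultimately show "\<rho> \<in> ?L" by (simp add: triangles_def)
qed

lemma edges_stack_all:
  "edges (stack_all K) = (`) Inl ` edges K \<union> {{Inl v, Inr \<sigma>} | v \<sigma>. \<sigma> \<in> triangles K \<and> v \<in> \<sigma>}"
    (is "?L = ?R")
proof (intro equalityI subsetI)
  fix \<rho> assume "\<rho> \<in> ?L"
  then have "\<rho> \<in> stack_all K" and card: "card \<rho> = 2" by (auto simp: edges_def)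
  from this(1) show "\<rho> \<in> ?R"
  proof (cases rule: stack_all_cases)
    case (old \<tau>) then show ?thesis using card by (simp add: card_image edges_def)
  next
    case (new \<sigma> \<tau>)
    have "finite \<sigma>" using new(3) by (metis card.infinite zero_neq_numeral)
    then have "finite \<tau>" using new(4) by (meson finite_subset psubset_imp_subset)
    moreover have "Inr \<sigma> \<notin> Inl ` \<tau>" by blast
    ultimately have "card \<tau> = 1" using card new(1) by (simp add: card_image)
    then obtain v where v: "\<tau> = {v}" by (meson card_1_singletonE)
    then have "\<rho> = {Inl v, Inr \<sigma>}" "v \<in> \<sigma>" using new(1,4) by auto
    then show ?thesis using new(2,3) by (auto simp: triangles_def)
  qed
next
  fix \<rho> assume "\<rho> \<in> ?R"
  then show "\<rho> \<in> ?L"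
  proof
    assume "\<rho> \<in> (`) Inl ` edges K"
    then obtain \<tau> where \<tau>: "\<rho> = Inl ` \<tau>" "\<tau> \<in> K" "card \<tau> = 2" by (auto simp: edges_def)
    then show ?thesis using stack_all_old[of \<tau> K] by (simp add: edges_def card_image)
  next
    assume "\<rho> \<in> {{Inl v, Inr \<sigma>} | v \<sigma>. \<sigma> \<in> triangles K \<and> v \<in> \<sigma>}"
    then obtain v \<sigma> where \<rho>: "\<rho> = {Inl v, Inr \<sigma>}" "\<sigma> \<in> K" "card \<sigma> = 3" "v \<in> \<sigma>"
      by (auto simp: triangles_def)
    have "card {v} \<noteq> card \<sigma>" using \<rho>(3) by simp
    then have "{v} \<subset> \<sigma>" using \<rho>(4) by blast
    from stack_all_new[OF \<rho>(2,3) this] have "\<rho> \<in> stack_all K"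
      using \<rho>(1) by (simp add: insert_commute)
    then show ?thesis using \<rho>(1) by (simp add: edges_def)
  qed
qed

text \<open>
  A vertex gains one edge for every triangle that contains it.
\<close>

lemma degree_stack_all:
  fixes v :: 'a
  assumes K: "finite_complex K"
  shows "degree_in (stack_all K) (Inl v) = degree_in K v + card {\<sigma> \<in> triangles K. v \<in> \<sigma>}"
proof -
  let ?E = "{e \<in> edges K. v \<in> e}" and ?T = "{\<sigma> \<in> triangles K. v \<in> \<sigma>}"
  let ?cone = "\<lambda>\<sigma>. {Inl v, Inr \<sigma>} :: ('a + 'a set) set"
  have fin: "finite ?E" "finite ?T"
    using K by (auto simp: edges_def triangles_def finite_complex_def)
  have "{e \<in> edges (stack_all K). Inl v \<in> e} = (`) Inl ` ?E \<union> ?cone ` ?T"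
    unfolding edges_stack_all by auto
  moreover have "((`) Inl ` ?E) \<inter> ?cone ` ?T = {}" by auto
  moreover have "inj_on ((`) Inl :: 'a set \<Rightarrow> ('a + 'a set) set) ?E"
    by (intro inj_onI) (simp add: inj_image_eq_iff)
  moreover have "inj_on ?cone ?T" by (intro inj_onI) (simp add: doubleton_eq_iff)
  ultimately show ?thesis
    unfolding degree_in_def using fin by (simp add: card_Un_disjoint card_image)
qed

lemma covered_stack_all:
  assumes K: "finite_complex K"
    and deg: "\<And>v. v \<in> vertices K \<Longrightarrow> degree_in K v = q"
    and tri: "\<And>v. v \<in> vertices K \<Longrightarrow> card {\<sigma> \<in> triangles K. v \<in> \<sigma>} = q"
  shows "covered (2 * q) (stack_all K)"
  unfolding covered_def
proof
  fix e assume "e \<in> edges (stack_all K)"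
  then obtain v where "Inl v \<in> e" "v \<in> vertices K"
    unfolding edges_stack_all
  proof
    assume "e \<in> (`) Inl ` edges K"
    then obtain \<tau> where \<tau>: "e = Inl ` \<tau>" "\<tau> \<in> K" "card \<tau> = 2" by (auto simp: edges_def)
    then obtain v where "v \<in> \<tau>" by (metis card_2_iff insertI1)
    then show ?thesis using that \<tau> by auto
  next
    assume "e \<in> {{Inl v, Inr \<sigma>} | v \<sigma>. \<sigma> \<in> triangles K \<and> v \<in> \<sigma>}"
    then show ?thesis using that by (auto simp: triangles_def)
  qed
  then show "\<exists>v\<in>e. degree_in (stack_all K) v = 2 * q"
    using degree_stack_all[OF K, of v] deg tri by (intro bexI[of _ "Inl v"]) simp_all
qed

text \<open>
  Every new triangle contains one edge of the old triangle \<open>\<sigma>\<close> and inherits the direction of this edge.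
\<close>

lemma orientable_stack_all:
  fixes K :: "'a set set"
  assumes "orientable K"
  shows "orientable (stack_all K)"
proof -
  obtain ori where ori: "\<And>\<sigma>. \<sigma> \<in> triangles K \<Longrightarrow> \<exists>a b c. \<sigma> = {a, b, c} \<and> ori \<sigma> = {(a, b), (b, c), (c, a)}"
    and disj: "\<And>\<sigma> \<tau>. \<sigma> \<in> triangles K \<Longrightarrow> \<tau> \<in> triangles K \<Longrightarrow> \<sigma> \<noteq> \<tau> \<Longrightarrow> ori \<sigma> \<inter> ori \<tau> = {}"
    using assms unfolding orientable_def by metis
  have cyc: "\<exists>a b c. \<sigma> = {a, b, c} \<and> a \<noteq> b \<and> b \<noteq> c \<and> a \<noteq> c \<and> ori \<sigma> = {(a, b), (b, c), (c, a)}"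
    if "\<sigma> \<in> triangles K" for \<sigma>
  proof -
    obtain a b c where abc: "\<sigma> = {a, b, c}" "ori \<sigma> = {(a, b), (b, c), (c, a)}" using ori[OF \<open>\<sigma> \<in> _\<close>] by blast
    have "card {a, b, c} = 3" using that abc by (simp add: triangles_def)
    then have "a \<noteq> b \<and> b \<noteq> c \<and> a \<noteq> c" by (auto simp: card_insert_if split: if_splits)
    with abc show ?thesis by blast
  qed
  have anti: "(b, a) \<notin> ori \<sigma>" if "\<sigma> \<in> triangles K" "(a, b) \<in> ori \<sigma>" for a b \<sigma>
  proof -
    obtain x y z where c: "\<sigma> = {x, y, z}" "x \<noteq> y" "y \<noteq> z" "x \<noteq> z" "ori \<sigma> = {(x, y), (y, z), (z, x)}"
      using cyc[OF \<open>\<sigma> \<in> triangles K\<close>] by blast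
    show ?thesis using that(2) c(2-4) unfolding c(5) unfolding c(1) by auto
  qed
  have total: "(a, b) \<in> ori \<sigma> \<or> (b, a) \<in> ori \<sigma>" if "\<sigma> \<in> triangles K" "a \<in> \<sigma>" "b \<in> \<sigma>" "a \<noteq> b" for a b \<sigma>
  proof -
    obtain x y z where c: "\<sigma> = {x, y, z}" "x \<noteq> y" "y \<noteq> z" "x \<noteq> z" "ori \<sigma> = {(x, y), (y, z), (z, x)}"
      using cyc[OF \<open>\<sigma> \<in> triangles K\<close>] by blast
    show ?thesis using that(2-4) c(2-4) unfolding c(5) unfolding c(1) by auto
  qed
  have succ: "b = b'" if "\<sigma> \<in> triangles K" "(a, b) \<in> ori \<sigma>" "(a, b') \<in> ori \<sigma>" for a b b' \<sigma>
  proof -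
    obtain x y z where c: "\<sigma> = {x, y, z}" "x \<noteq> y" "y \<noteq> z" "x \<noteq> z" "ori \<sigma> = {(x, y), (y, z), (z, x)}"
      using cyc[OF \<open>\<sigma> \<in> triangles K\<close>] by blast
    show ?thesis using that(2,3) c(2-4) unfolding c(5) unfolding c(1) by auto
  qed
  have pred: "a = a'" if "\<sigma> \<in> triangles K" "(a, b) \<in> ori \<sigma>" "(a', b) \<in> ori \<sigma>" for a a' b \<sigma>
  proof -
    obtain x y z where c: "\<sigma> = {x, y, z}" "x \<noteq> y" "y \<noteq> z" "x \<noteq> z" "ori \<sigma> = {(x, y), (y, z), (z, x)}"
      using cyc[OF \<open>\<sigma> \<in> triangles K\<close>] by blast
    show ?thesis using that(2,3) c(2-4) unfolding c(5) unfolding c(1) by auto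
  qed
  define ori' :: "('a + 'a set) set \<Rightarrow> (('a + 'a set) \<times> ('a + 'a set)) set" where
    "ori' \<rho> = (\<Union>(a, b, \<sigma>)\<in>{(a, b, \<sigma>). \<sigma> \<in> triangles K \<and> (a, b) \<in> ori \<sigma> \<and> \<rho> = {Inl a, Inl b, Inr \<sigma>}}.
       {(Inl a, Inl b), (Inl b, Inr \<sigma>), (Inr \<sigma>, Inl a)})" for \<rho>
  have tri: "\<exists>a b \<sigma>. \<sigma> \<in> triangles K \<and> (a, b) \<in> ori \<sigma> \<and> \<rho> = {Inl a, Inl b, Inr \<sigma>}"
    if \<rho>: "\<rho> \<in> triangles (stack_all K)" for \<rho>
  proof -
    obtain a b \<sigma> where \<rho>: "\<sigma> \<in> triangles K" "a \<in> \<sigma>" "b \<in> \<sigma>" "a \<noteq> b" "\<rho> = {Inl a, Inl b, Inr \<sigma>}"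
      using \<rho> unfolding triangles_stack_all by blast
    then have "\<rho> = {Inl b, Inl a, Inr \<sigma>}" by (simp add: insert_commute)
    with \<rho> total[OF \<rho>(1-4)] show ?thesis by blast
  qed
  have ori': "ori' {Inl a, Inl b, Inr \<sigma>} = {(Inl a, Inl b), (Inl b, Inr \<sigma>), (Inr \<sigma>, Inl a)}"
    if \<sigma>: "\<sigma> \<in> triangles K" "(a, b) \<in> ori \<sigma>" for a b \<sigma>
  proof -
    have "{(a', b', \<sigma>'). \<sigma>' \<in> triangles K \<and> (a', b') \<in> ori \<sigma>' \<and>
        {Inl a, Inl b, Inr \<sigma>} = ({Inl a', Inl b', Inr \<sigma>'} :: ('a + 'a set) set)} = {(a, b, \<sigma>)}" (is "?M = _")
    proof (intro equalityI subsetI)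
      fix p assume "p \<in> ?M"
      then obtain a' b' \<sigma>' where p: "p = (a', b', \<sigma>')" "\<sigma>' \<in> triangles K" "(a', b') \<in> ori \<sigma>'"
        and eq: "{Inl a, Inl b, Inr \<sigma>} = ({Inl a', Inl b', Inr \<sigma>'} :: ('a + 'a set) set)" by blast
      have "Inr \<sigma> \<in> ({Inl a', Inl b', Inr \<sigma>'} :: ('a + 'a set) set)" unfolding eq[symmetric] by simp
      then have "\<sigma> = \<sigma>'" by simp
      have "Inl a \<in> ({Inl a', Inl b', Inr \<sigma>'} :: ('a + 'a set) set)"
        "Inl b \<in> ({Inl a', Inl b', Inr \<sigma>'} :: ('a + 'a set) set)" unfolding eq[symmetric] by simp_all
      then have ab: "a = a' \<or> a = b'" "b = a' \<or> b = b'" by simp_all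
      have "a \<noteq> b" using cyc[OF \<sigma>(1)] \<sigma>(2) by auto
      then have "(a = a' \<and> b = b') \<or> (a = b' \<and> b = a')" using ab by blast
      then have "a = a' \<and> b = b'" using anti[OF \<sigma>] p(3) \<open>\<sigma> = \<sigma>'\<close> by blast
      then show "p \<in> {(a, b, \<sigma>)}" using p(1) \<open>\<sigma> = \<sigma>'\<close> by simp
    qed (use \<sigma> in simp)
    then show ?thesis unfolding ori'_def by simp
  qed
  show ?thesis
    unfolding orientable_def
  proof (intro exI[of _ ori'] conjI ballI impI)
    fix \<rho> assume "\<rho> \<in> triangles (stack_all K)"
    then obtain a b \<sigma> where "\<sigma> \<in> triangles K" "(a, b) \<in> ori \<sigma>" "\<rho> = {Inl a, Inl b, Inr \<sigma>}" using tri by blast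
    then show "\<exists>a b c. \<rho> = {a, b, c} \<and> ori' \<rho> = {(a, b), (b, c), (c, a)}" using ori' by blast
  next
    fix \<rho> \<rho>' assume \<rho>: "\<rho> \<in> triangles (stack_all K)" "\<rho>' \<in> triangles (stack_all K)" "\<rho> \<noteq> \<rho>'"
    obtain a b \<sigma> where 1: "\<sigma> \<in> triangles K" "(a, b) \<in> ori \<sigma>" "\<rho> = {Inl a, Inl b, Inr \<sigma>}" using tri[OF \<rho>(1)] by blast
    obtain a' b' \<sigma>' where 2: "\<sigma>' \<in> triangles K" "(a', b') \<in> ori \<sigma>'" "\<rho>' = {Inl a', Inl b', Inr \<sigma>'}" using tri[OF \<rho>(2)] by blast
    have same: "\<sigma> \<noteq> \<sigma>' \<or> (a \<noteq> a' \<and> b \<noteq> b')"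
    proof (rule ccontr)
      assume *: "\<not> ?thesis"
      then have "\<sigma> = \<sigma>'" "a = a' \<or> b = b'" by auto
      then have "a = a' \<and> b = b'" using succ[OF 1(1)] pred[OF 1(1)] 1(2) 2(2) by blast
      then show False using \<open>\<sigma> = \<sigma>'\<close> 1(3) 2(3) \<rho>(3) by simp
    qed
    moreover have "(a, b) \<noteq> (a', b')" if "\<sigma> \<noteq> \<sigma>'"
      using disj[OF 1(1) 2(1) that] 1(2) 2(2) by blast
    ultimately show "ori' \<rho> \<inter> ori' \<rho>' = {}"
      unfolding 1(3) 2(3) ori'[OF 1(1,2)] ori'[OF 2(1,2)] by auto
  qed
qed

section \<open>Counting and orientation from vertex links\<close>

text \<open>
  Here the length of the link, at least 3, is used.
\<close>

lemma link_cycle_no_short_orbit: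
  assumes "link_cycle K v f L" "x \<in> L"
  shows "f x \<in> L" "f x \<noteq> x" "f (f x) \<noteq> x"
proof -
  define m where "m = card L"
  have m: "3 \<le> m" using assms by (simp add: link_cycle_def m_def)
  have cyc: "cyclic_on f L" using assms(1) by (simp add: link_cycle_def)
  obtain w where w: "bij_betw w {..<m} L" "\<And>i. i < m \<Longrightarrow> f (w i) = w (Suc i mod m)"
    using cyclic_on_enumerate[OF cyc] unfolding m_def by metis
  obtain i where i: "i < m" "x = w i" using w(1) assms(2) by (auto simp: bij_betw_def)
  define j where "j = Suc i mod m"
  define l where "l = Suc j mod m"
  have jl: "j < m" "l < m" using m by (auto simp: j_def l_def)
  have "j \<noteq> i" "l \<noteq> i" using m i(1) by (auto simp: j_def l_def mod_if)
  moreover have "f x = w j" "f (f x) = w l" using w(2) i jl by (simp_all add: j_def l_def)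
  moreover have "w a \<noteq> w i" if "a < m" "a \<noteq> i" for a
    using w(1) that i(1) by (auto simp: bij_betw_def inj_on_def)
  ultimately show "f x \<in> L" "f x \<noteq> x" "f (f x) \<noteq> x"
    using jl i w(1) by (auto simp: bij_betw_def)
qed

lemma link_cycle_card_triangle:
  assumes "link_cycle K v f L" "x \<in> L"
  shows "card {v, x, f x} = 3"
proof -
  have "v \<notin> L" using assms(1) by (simp add: link_cycle_def)
  then have "v \<noteq> x" "v \<noteq> f x" "x \<noteq> f x" using assms(2) link_cycle_no_short_orbit[OF assms] by auto
  then show ?thesis by simp
qed

lemma link_cycle_edges:
  assumes "link_cycle K v f L"
  shows "{e \<in> edges K. v \<in> e} = (\<lambda>x. {v, x}) ` L"
proof -
  have K: "{\<sigma>\<in>K. v \<in> \<sigma>} = insert {v} ({{v, x} | x. x \<in> L} \<union> {{v, x, f x} | x. x \<in> L})"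
    and v: "v \<notin> L" using assms by (simp_all add: link_cycle_def)
  have "{e \<in> edges K. v \<in> e} = {\<sigma> \<in> {\<sigma>\<in>K. v \<in> \<sigma>}. card \<sigma> = 2}" by (auto simp: edges_def)
  also have "\<dots> = (\<lambda>x. {v, x}) ` L"
  proof (intro equalityI subsetI)
    fix \<sigma> assume "\<sigma> \<in> {\<sigma> \<in> {\<sigma>\<in>K. v \<in> \<sigma>}. card \<sigma> = 2}"
    then have "\<sigma> = {v} \<or> (\<exists>x\<in>L. \<sigma> = {v, x}) \<or> (\<exists>x\<in>L. \<sigma> = {v, x, f x})" "card \<sigma> = 2"
      unfolding K by blast+
    then show "\<sigma> \<in> (\<lambda>x. {v, x}) ` L" using link_cycle_card_triangle[OF assms] by auto
  next
    fix \<sigma> assume "\<sigma> \<in> (\<lambda>x. {v, x}) ` L"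
    then obtain x where x: "x \<in> L" "\<sigma> = {v, x}" by blast
    then have "v \<noteq> x" using v by blast
    then have "card \<sigma> = 2" using x(2) by simp
    moreover have "\<sigma> \<in> {\<sigma>\<in>K. v \<in> \<sigma>}" unfolding K using x by blast
    ultimately show "\<sigma> \<in> {\<sigma> \<in> {\<sigma>\<in>K. v \<in> \<sigma>}. card \<sigma> = 2}" by simp
  qed
  finally show ?thesis .
qed

lemma link_cycle_degree:
  assumes "link_cycle K v f L"
  shows "degree_in K v = card L"
  unfolding degree_in_def link_cycle_edges[OF assms]
  by (rule card_image) (auto simp: inj_on_def doubleton_eq_iff)

lemma link_cycle_triangles:
  assumes "link_cycle K v f L"
  shows "{\<sigma> \<in> triangles K. v \<in> \<sigma>} = (\<lambda>x. {v, x, f x}) ` L"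
proof -
  have K: "{\<sigma>\<in>K. v \<in> \<sigma>} = insert {v} ({{v, x} | x. x \<in> L} \<union> {{v, x, f x} | x. x \<in> L})"
    using assms by (simp add: link_cycle_def)
  have "{\<sigma> \<in> triangles K. v \<in> \<sigma>} = {\<sigma> \<in> {\<sigma>\<in>K. v \<in> \<sigma>}. card \<sigma> = 3}" by (auto simp: triangles_def)
  also have "\<dots> = (\<lambda>x. {v, x, f x}) ` L"
  proof (intro equalityI subsetI)
    fix \<sigma> assume "\<sigma> \<in> {\<sigma> \<in> {\<sigma>\<in>K. v \<in> \<sigma>}. card \<sigma> = 3}"
    then have "\<sigma> = {v} \<or> (\<exists>x\<in>L. \<sigma> = {v, x}) \<or> (\<exists>x\<in>L. \<sigma> = {v, x, f x})" "card \<sigma> = 3"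
      unfolding K by blast+
    moreover have "card {v, x} \<noteq> 3" for x by (simp add: card_insert_if)
    ultimately show "\<sigma> \<in> (\<lambda>x. {v, x, f x}) ` L" by auto
  next
    fix \<sigma> assume "\<sigma> \<in> (\<lambda>x. {v, x, f x}) ` L"
    then obtain x where x: "x \<in> L" "\<sigma> = {v, x, f x}" by blast
    then have "card \<sigma> = 3" using link_cycle_card_triangle[OF assms] by simp
    moreover have "\<sigma> \<in> {\<sigma>\<in>K. v \<in> \<sigma>}" unfolding K using x by blast
    ultimately show "\<sigma> \<in> {\<sigma> \<in> {\<sigma>\<in>K. v \<in> \<sigma>}. card \<sigma> = 3}" by simp
  qed
  finally show ?thesis .
qed

lemma link_cycle_card_triangles:
  assumes "link_cycle K v f L"
  shows "card {\<sigma> \<in> triangles K. v \<in> \<sigma>} = card L"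
  unfolding link_cycle_triangles[OF assms]
proof (rule card_image, rule inj_onI)
  fix x y assume xy: "x \<in> L" "y \<in> L" "{v, x, f x} = {v, y, f y}"
  have v: "v \<notin> L" using assms by (simp add: link_cycle_def)
  note x = link_cycle_no_short_orbit[OF assms xy(1)] and y = link_cycle_no_short_orbit[OF assms xy(2)]
  have "{x, f x} = {v, x, f x} - {v}" using v xy(1) x(1) by auto
  also have "\<dots> = {v, y, f y} - {v}" using xy(3) by simp
  also have "\<dots> = {y, f y}" using v xy(2) y(1) by auto
  finally have "x = y \<and> f x = f y \<or> x = f y \<and> f x = y" by (simp add: doubleton_eq_iff)
  then show "x = y" using x(3) by auto
qed

lemma link_cycle_dimension:
  assumes link: "\<And>v. v \<in> vertices K \<Longrightarrow> \<exists>f L. link_cycle K v f L" and K: "finite_complex K" and \<sigma>: "\<sigma> \<in> K"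
  shows "card \<sigma> \<le> 3"
proof -
  have "\<sigma> \<noteq> {}" using K \<sigma> unfolding finite_complex_def by blast
  then obtain v where v: "v \<in> \<sigma>" by blast
  then obtain f L where "link_cycle K v f L" using link \<sigma> by blast
  then have *: "{\<sigma>\<in>K. v \<in> \<sigma>} = insert {v} ({{v, x} | x. x \<in> L} \<union> {{v, x, f x} | x. x \<in> L})"
    by (simp add: link_cycle_def)
  have "\<sigma> \<in> {\<sigma>\<in>K. v \<in> \<sigma>}" using v \<sigma> by simp
  then have "\<sigma> = {v} \<or> (\<exists>x. \<sigma> = {v, x}) \<or> (\<exists>x. \<sigma> = {v, x, f x})" unfolding * by blast
  then show ?thesis by (auto simp: card_insert_if)
qed

lemma double_count_faces:
  assumes K: "finite_complex K" and S: "S \<subseteq> K"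
    and q: "\<And>v. v \<in> vertices K \<Longrightarrow> card {\<sigma> \<in> S. v \<in> \<sigma>} = q" and c: "\<And>\<sigma>. \<sigma> \<in> S \<Longrightarrow> card \<sigma> = c"
  shows "c * card S = q * card (vertices K)"
proof -
  have finK: "finite K" using K by (simp add: finite_complex_def)
  then have fin: "finite S" "finite (vertices K)"
    using S finite_subset finite_complex_finite[OF K] by auto
  have "{v \<in> vertices K. v \<in> \<sigma>} = \<sigma>" if "\<sigma> \<in> S" for \<sigma> using that S by blast
  then have "\<forall>\<sigma>\<in>S. card {v \<in> vertices K. v \<in> \<sigma>} = c" using c by simp
  then have "(\<Sum>v\<in>vertices K. card {\<sigma> \<in> S. v \<in> \<sigma>}) = (\<Sum>\<sigma>\<in>S. c)"
    using fin by (intro sum_multicount_gen) auto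
  then show ?thesis using q by (simp add: mult.commute)
qed

text \<open>
  Double counting of incidences: if all vertices have degree \<open>q\<close> and lie in \<open>q\<close> triangles, then there are
  \<open>q / 2\<close> edges and \<open>q / 3\<close> triangles per vertex.
\<close>

lemma euler_char_equivelar:
  assumes K: "finite_complex K" and dim: "\<And>\<sigma>. \<sigma> \<in> K \<Longrightarrow> card \<sigma> \<le> 3"
    and deg: "\<And>v. v \<in> vertices K \<Longrightarrow> degree_in K v = q"
    and tri: "\<And>v. v \<in> vertices K \<Longrightarrow> card {\<sigma> \<in> triangles K. v \<in> \<sigma>} = q"
  shows "6 * euler_char K = (6 - int q) * int (card (vertices K))"
proof -
  let ?P = "{\<sigma> \<in> K. card \<sigma> = 1}" and ?f = "\<lambda>\<sigma>. (-1::int) ^ (card \<sigma> - 1)"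
  have finK: "finite K" using K by (simp add: finite_complex_def)
  have "1 \<le> card \<sigma>" if "\<sigma> \<in> K" for \<sigma>
    using K that by (auto simp: finite_complex_def card_gt_0_iff Suc_le_eq)
  then have "card \<sigma> = 1 \<or> card \<sigma> = 2 \<or> card \<sigma> = 3" if "\<sigma> \<in> K" for \<sigma>
    using dim[OF that] that by force
  then have part: "K = ?P \<union> (edges K \<union> triangles K)" by (auto simp: edges_def triangles_def)
  have "euler_char K = (\<Sum>\<sigma>\<in>?P \<union> (edges K \<union> triangles K). ?f \<sigma>)"
    unfolding euler_char_def using part by (rule arg_cong[where f = "sum ?f"])
  also have "\<dots> = (\<Sum>\<sigma>\<in>?P. ?f \<sigma>) + ((\<Sum>\<sigma>\<in>edges K. ?f \<sigma>) + (\<Sum>\<sigma>\<in>triangles K. ?f \<sigma>))"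
    using finK by (subst sum.union_disjoint, (auto simp: edges_def triangles_def)[3], subst sum.union_disjoint)
      (auto simp: edges_def triangles_def)
  also have "(\<Sum>\<sigma>\<in>?P. ?f \<sigma>) = int (card ?P)" by simp
  also have "(\<Sum>\<sigma>\<in>edges K. ?f \<sigma>) = - int (card (edges K))" by (simp add: edges_def)
  also have "(\<Sum>\<sigma>\<in>triangles K. ?f \<sigma>) = int (card (triangles K))" by (simp add: triangles_def)
  finally have euler: "euler_char K = int (card ?P) - int (card (edges K)) + int (card (triangles K))" by simp
  have "?P = (\<lambda>v. {v}) ` vertices K"
  proof (intro equalityI subsetI)
    fix \<sigma> assume "\<sigma> \<in> ?P"
    then have "\<sigma> \<in> K" "card \<sigma> = 1" by simp_all
    moreover from this(2) obtain v where "\<sigma> = {v}" by (rule card_1_singletonE)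
    ultimately show "\<sigma> \<in> (\<lambda>v. {v}) ` vertices K" by blast
  next
    fix \<sigma> assume "\<sigma> \<in> (\<lambda>v. {v}) ` vertices K"
    then obtain v \<tau> where "\<tau> \<in> K" "v \<in> \<tau>" "\<sigma> = {v}" by blast
    then show "\<sigma> \<in> ?P" using finite_complex_face[OF K, of \<tau> "{v}"] by simp
  qed
  then have P: "card ?P = card (vertices K)" by (simp add: card_image)
  have "2 * card (edges K) = q * card (vertices K)"
    using deg by (intro double_count_faces[OF K]) (auto simp: edges_def degree_in_def)
  then have E: "2 * int (card (edges K)) = int q * int (card (vertices K))" by (metis of_nat_mult of_nat_numeral)
  have "3 * card (triangles K) = q * card (vertices K)"
    using tri by (intro double_count_faces[OF K]) (auto simp: triangles_def)
  then have T: "3 * int (card (triangles K)) = int q * int (card (vertices K))" by (metis of_nat_mult of_nat_numeral)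
  have "6 * euler_char K = 6 * int (card ?P) - 3 * (2 * int (card (edges K))) + 2 * (3 * int (card (triangles K)))"
    unfolding euler by simp
  also have "\<dots> = (6 - int q) * int (card (vertices K))" unfolding E T P by (simp add: algebra_simps)
  finally show ?thesis .
qed

text \<open>
  The successor of \<open>x\<close> in the link of \<open>v\<close> is \<open>r v x\<close>, so \<open>(v, x, r v x)\<close> is an oriented triangle. The coherence
  condition says that it is also oriented as seen from \<open>x\<close>, in the cyclic order \<open>(x, r v x, v)\<close>. A directed
  edge then determines the triangle on one of its sides.
\<close>

lemma orientable_if_coherent:
  fixes K :: "'a set set" and r :: "'a \<Rightarrow> 'a \<Rightarrow> 'a"
  assumes link: "\<And>v. v \<in> vertices K \<Longrightarrow> link_cycle K v (r v) (N v)"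
    and coh: "\<And>v x. v \<in> vertices K \<Longrightarrow> x \<in> N v \<Longrightarrow> r x (r v x) = v"
  shows "orientable K"
proof -
  define ori where "ori \<sigma> = {(v, x). v \<in> vertices K \<and> x \<in> N v \<and> \<sigma> = {v, x, r v x}}" for \<sigma>
  have nbr: "x \<in> N v \<longleftrightarrow> {v, x} \<in> edges K" if v: "v \<in> vertices K" for v x
  proof
    assume "x \<in> N v"
    then have "{v, x} \<in> {e \<in> edges K. v \<in> e}" unfolding link_cycle_edges[OF link[OF v]] by blast
    then show "{v, x} \<in> edges K" by simp
  next
    assume "{v, x} \<in> edges K"
    then have "{v, x} \<in> {e \<in> edges K. v \<in> e}" by simp
    then obtain y where "y \<in> N v" "{v, x} = {v, y}" unfolding link_cycle_edges[OF link[OF v]] by blast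
    then show "x \<in> N v" by (auto simp: doubleton_eq_iff)
  qed
  have turn: "x \<in> vertices K \<and> r v x \<in> N x" if v: "v \<in> vertices K" and x: "x \<in> N v" for v x
  proof -
    have "{v, x} \<in> edges K" using nbr v x by blast
    then have xK: "x \<in> vertices K" by (auto simp: edges_def)
    have "{x, v} \<in> edges K" using \<open>{v, x} \<in> edges K\<close> by (simp add: insert_commute)
    then have "v \<in> N x" using nbr xK by blast
    have "{v, x, r v x} \<in> {\<sigma> \<in> triangles K. v \<in> \<sigma>}"
      unfolding link_cycle_triangles[OF link[OF v]] using x by blast
    then have "{v, x, r v x} \<in> {\<sigma> \<in> triangles K. x \<in> \<sigma>}" by simp
    then obtain y where y: "y \<in> N x" "{v, x, r v x} = {x, y, r x y}"
      unfolding link_cycle_triangles[OF link[OF xK]] by blast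
    have "r v x \<noteq> x" using link_cycle_no_short_orbit(2)[OF link[OF v] x] .
    moreover have "r v x \<in> {x, y, r x y}" using y(2) by blast
    moreover have "r x y \<in> N x" using link_cycle_no_short_orbit(1)[OF link[OF xK] y(1)] .
    ultimately have "r v x = y \<or> r v x = r x y" by simp
    then show ?thesis using y(1) xK \<open>r x y \<in> N x\<close> by auto
  qed
  show ?thesis
    unfolding orientable_def
  proof (intro exI[of _ ori] conjI ballI impI)
    fix \<sigma> assume \<sigma>: "\<sigma> \<in> triangles K"
    then have "\<sigma> \<noteq> {}" by (auto simp: triangles_def)
    then obtain v where "v \<in> \<sigma>" by blast
    then have v: "v \<in> vertices K" "\<sigma> \<in> {\<sigma> \<in> triangles K. v \<in> \<sigma>}" using \<sigma> by (auto simp: triangles_def)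
    then obtain x where x: "x \<in> N v" "\<sigma> = {v, x, r v x}"
      unfolding link_cycle_triangles[OF link[OF v(1)]] by blast
    define y where "y = r v x"
    have xK: "x \<in> vertices K" and yN: "y \<in> N x" using turn[OF v(1) x(1)] by (simp_all add: y_def)
    have xy: "r x y = v" using coh[OF v(1) x(1)] by (simp add: y_def)
    have yK: "y \<in> vertices K" and vN: "v \<in> N y" using turn[OF xK yN] xy by simp_all
    have yv: "r y v = x" using coh[OF xK yN] xy by simp
    have not_back: "r v y \<noteq> x" "r x v \<noteq> y" "r y x \<noteq> v"
      using link_cycle_no_short_orbit(3)[OF link[OF v(1)] x(1)]
        link_cycle_no_short_orbit(3)[OF link[OF xK] yN] link_cycle_no_short_orbit(3)[OF link[OF yK] vN] xy yv
      by (simp_all add: y_def)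
    have "card \<sigma> = 3" using \<sigma> by (simp add: triangles_def)
    then have neq: "v \<noteq> x" "x \<noteq> y" "v \<noteq> y" unfolding x(2) y_def[symmetric] by (auto simp: card_insert_if split: if_splits)
    have \<sigma>_eq: "\<sigma> = {v, x, y}" using x(2) by (simp add: y_def)
    have "ori \<sigma> = {(v, x), (x, y), (y, v)}"
    proof (intro equalityI subsetI)
      fix p assume "p \<in> ori \<sigma>"
      then obtain a b where p: "p = (a, b)" "a \<in> vertices K" "b \<in> N a" "\<sigma> = {a, b, r a b}" by (auto simp: ori_def)
      have "card \<sigma> = 3" by fact
      then have ab: "a \<noteq> b" "a \<noteq> r a b" "b \<noteq> r a b" unfolding p(4) by (auto simp: card_insert_if split: if_splits)
      have in3: "a \<in> {v, x, y}" "b \<in> {v, x, y}" "r a b \<in> {v, x, y}" using p(4) \<sigma>_eq by blast+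
      show "p \<in> {(v, x), (x, y), (y, v)}"
        using in3 ab not_back unfolding p(1) by auto
    next
      fix p assume "p \<in> {(v, x), (x, y), (y, v)}"
      then consider "p = (v, x)" | "p = (x, y)" | "p = (y, v)" by blast
      then show "p \<in> ori \<sigma>"
      proof cases
        case 1 then show ?thesis using v(1) x by (simp add: ori_def)
      next
        case 2 then show ?thesis using xK yN xy \<sigma>_eq by (auto simp: ori_def)
      next
        case 3 then show ?thesis using yK vN yv \<sigma>_eq by (auto simp: ori_def)
      qed
    qed
    then show "\<exists>a b c. \<sigma> = {a, b, c} \<and> ori \<sigma> = {(a, b), (b, c), (c, a)}" using \<sigma>_eq by blast
  next
    fix \<sigma> \<tau> :: "'a set" assume "\<sigma> \<noteq> \<tau>"
    then show "ori \<sigma> \<inter> ori \<tau> = {}" by (auto simp: ori_def)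
  qed
qed

section \<open>The rotation of differences\<close>

text \<open>
  The differences between adjacent vertices, as integers of least absolute value.
\<close>

definition rotation_range :: "int \<Rightarrow> int set" where
  "rotation_range k = {d. d \<noteq> 0 \<and> \<bar>d\<bar> \<le> 6 * k + 3}"

text \<open>
  The successor map in the link of the vertex 0: \<open>(0, d, rho k d)\<close> is the oriented triangle that contains the
  directed edge from 0 to \<open>d\<close>; only the values on \<^const>\<open>rotation_range\<close> matter. It is read off from the generating triangles, of which \<open>[0, 2j, 3k+2+j]\<close>,
  \<open>[0, 4k+3+j, 6k+4-j]\<close>, \<open>[0, 2k+1, 5k+3]\<close> and \<open>[0, 5k+3, 5k+4]\<close> take the orientation opposite to the listed one; a generating
  triangle that is oriented as \<open>(0, b, c)\<close> contributes \<open>b\<close> to \<open>c\<close>, \<open>c - b\<close> to \<open>- b\<close> and \<open>- c\<close> to \<open>b - c\<close>. No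
  reduction modulo \<open>n\<close> is needed.
\<close>

definition rho :: "int \<Rightarrow> int \<Rightarrow> int" where
  "rho k d =
   (if 0 < d \<and> d \<le> 2 * k then (if odd d then 3 * k + 2 + (d + 1) div 2 else d div 2 - 5 * k - 3)
    else if d = 2 * k + 1 then - (2 * k + 2)
    else if d = 2 * k + 2 then 4 * k + 3
    else if 2 * k + 2 < d \<and> d \<le> 3 * k + 2 then 2 * d - 6 * k - 5
    else if 3 * k + 2 < d \<and> d \<le> 4 * k + 2 then 2 * d - 6 * k - 4
    else if 4 * k + 2 < d \<and> d \<le> 5 * k + 2 then 10 * k + 6 - d
    else if d = 5 * k + 3 then 2 * k + 1
    else if 5 * k + 3 < d then 10 * k + 7 - d
    else if - 2 * k \<le> d then (if odd d then - ((1 - d) div 2) - 5 * k - 3 else 3 * k + 2 - (- d) div 2)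
    else if d = - (2 * k + 1) then 3 * k + 2
    else if - (3 * k + 1) \<le> d then - (6 * k + 4) - d
    else if d = - (3 * k + 2) then - (5 * k + 3)
    else if - (4 * k + 2) \<le> d then - (6 * k + 5) - d
    else if d = - (4 * k + 3) then - (2 * k + 1)
    else if - (5 * k + 2) \<le> d then 2 * d + 10 * k + 7
    else if d = - (5 * k + 3) then 1
    else 2 * d + 10 * k + 6)"

context
  fixes k :: int
  assumes k: "1 \<le> k"
begin

text \<open>
  The values of \<^const>\<open>rho\<close> in parametrized form. The cycle runs through them in the order 1, 3, 2, 4 (for
  \<open>j = 1, \<dots>, k\<close>, ending with 5 instead of 4), 6, 7 (for \<open>j = 0\<close>), then 8, 9, 10, 7 (for \<open>j = 1, \<dots>, k\<close>, ending
  with 11 instead of 7), 12, 13 (for \<open>j = 1, \<dots>, k\<close>), 14, 15, then 16, 17 (for \<open>j = 1, \<dots>, k\<close>), 18, 19.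
\<close>

lemma rho_simps:
  "1 \<le> j \<Longrightarrow> j \<le> k \<Longrightarrow> rho k (2 * j - 1) = 3 * k + 2 + j"
  "1 \<le> j \<Longrightarrow> j \<le> k \<Longrightarrow> rho k (2 * j) = j - 5 * k - 3"
  "1 \<le> j \<Longrightarrow> j \<le> k \<Longrightarrow> rho k (3 * k + 2 + j) = 2 * j"
  "1 \<le> j \<Longrightarrow> j < k \<Longrightarrow> rho k (j - 5 * k - 3) = 2 * j + 1"
  "rho k (- 4 * k - 3) = - 2 * k - 1"
  "rho k (- 2 * k - 1) = 3 * k + 2"
  "0 \<le> j \<Longrightarrow> j < k \<Longrightarrow> rho k (3 * k + 2 - j) = - 2 * j - 1"
  "1 \<le> j \<Longrightarrow> j \<le> k \<Longrightarrow> rho k (1 - 2 * j) = - 5 * k - 3 - j"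
  "1 \<le> j \<Longrightarrow> j \<le> k \<Longrightarrow> rho k (- 5 * k - 3 - j) = - 2 * j"
  "1 \<le> j \<Longrightarrow> j \<le> k \<Longrightarrow> rho k (- 2 * j) = 3 * k + 2 - j"
  "rho k (2 * k + 2) = 4 * k + 3"
  "1 \<le> j \<Longrightarrow> j \<le> k \<Longrightarrow> rho k (4 * k + 2 + j) = 6 * k + 4 - j"
  "1 \<le> j \<Longrightarrow> j \<le> k \<Longrightarrow> rho k (6 * k + 4 - j) = 4 * k + 3 + j"
  "rho k (5 * k + 3) = 2 * k + 1"
  "rho k (2 * k + 1) = - 2 * k - 2"
  "1 \<le> j \<Longrightarrow> j \<le> k \<Longrightarrow> rho k (- 2 * k - 1 - j) = j - 4 * k - 3"
  "1 \<le> j \<Longrightarrow> j \<le> k \<Longrightarrow> rho k (j - 4 * k - 3) = - 2 * k - 2 - j"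
  "rho k (- 3 * k - 2) = - 5 * k - 3"
  "rho k (- 5 * k - 3) = 1"
  using k by (simp_all add: rho_def)

lemma rotation_range_cases:
  assumes "d \<in> rotation_range k"
  obtains
    (1) j where "1 \<le> j" "j \<le> k" "d = 2 * j - 1"
  | (2) j where "1 \<le> j" "j \<le> k" "d = 2 * j"
  | (3) j where "1 \<le> j" "j \<le> k" "d = 3 * k + 2 + j"
  | (4) j where "1 \<le> j" "j < k" "d = j - 5 * k - 3"
  | (5) "d = - 4 * k - 3"
  | (6) "d = - 2 * k - 1"
  | (7) j where "0 \<le> j" "j < k" "d = 3 * k + 2 - j"
  | (8) j where "1 \<le> j" "j \<le> k" "d = 1 - 2 * j"
  | (9) j where "1 \<le> j" "j \<le> k" "d = - 5 * k - 3 - j"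
  | (10) j where "1 \<le> j" "j \<le> k" "d = - 2 * j"
  | (11) "d = 2 * k + 2"
  | (12) j where "1 \<le> j" "j \<le> k" "d = 4 * k + 2 + j"
  | (13) j where "1 \<le> j" "j \<le> k" "d = 6 * k + 4 - j"
  | (14) "d = 5 * k + 3"
  | (15) "d = 2 * k + 1"
  | (16) j where "1 \<le> j" "j \<le> k" "d = - 2 * k - 1 - j"
  | (17) j where "1 \<le> j" "j \<le> k" "d = j - 4 * k - 3"
  | (18) "d = - 3 * k - 2"
  | (19) "d = - 5 * k - 3"
proof -
  have d: "d \<noteq> 0" "d \<le> 6 * k + 3" "- 6 * k - 3 \<le> d" using assms by (auto simp: rotation_range_def)
  consider "1 \<le> d \<and> d \<le> 2 * k" | "d = 2 * k + 1" | "d = 2 * k + 2" | "2 * k + 3 \<le> d \<and> d \<le> 3 * k + 2"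
    | "3 * k + 3 \<le> d \<and> d \<le> 4 * k + 2" | "4 * k + 3 \<le> d \<and> d \<le> 5 * k + 2" | "d = 5 * k + 3" | "5 * k + 4 \<le> d"
    | "d \<le> - 1 \<and> - 2 * k \<le> d" | "d = - 2 * k - 1" | "d \<le> - 2 * k - 2 \<and> - 3 * k - 1 \<le> d" | "d = - 3 * k - 2"
    | "d \<le> - 3 * k - 3 \<and> - 4 * k - 2 \<le> d" | "d = - 4 * k - 3" | "d \<le> - 4 * k - 4 \<and> - 5 * k - 2 \<le> d"
    | "d = - 5 * k - 3" | "d \<le> - 5 * k - 4"
    using d(1) by smt
  then show ?thesis
  proof cases
    case a: 1
    show ?thesis
    proof (cases "odd d")
      case True then show ?thesis using a by (intro 1[of "(d + 1) div 2"]) presburger+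
    next
      case False then show ?thesis using a by (intro 2[of "d div 2"]) presburger+
    qed
  next
    case a: 9
    show ?thesis
    proof (cases "odd d")
      case True then show ?thesis using a by (intro 8[of "(1 - d) div 2"]) presburger+
    next
      case False then show ?thesis using a by (intro 10[of "(- d) div 2"]) presburger+
    qed
  next
    case 2 then show ?thesis using 15 by simp
  next
    case 3 then show ?thesis using 11 by simp
  next
    case 4 then show ?thesis using 7[of "3 * k + 2 - d"] by simp
  next
    case 5 then show ?thesis using 3[of "d - 3 * k - 2"] by simp
  next
    case 6 then show ?thesis using 12[of "d - 4 * k - 2"] by simp
  next
    case 7 then show ?thesis using 14 by simp
  next
    case 8 then show ?thesis using 13[of "6 * k + 4 - d"] d by simp
  next
    case 10 then show ?thesis using 6 by simp
  next
    case 11 then show ?thesis using 16[of "- 2 * k - 1 - d"] by simp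
  next
    case 12 then show ?thesis using 18 by simp
  next
    case 13 then show ?thesis using 17[of "d + 4 * k + 3"] by simp
  next
    case 14 then show ?thesis using 5 by simp
  next
    case 15 then show ?thesis using 4[of "d + 5 * k + 3"] by simp
  next
    case 16 then show ?thesis using 19 by simp
  next
    case 17 then show ?thesis using 9[of "- 5 * k - 3 - d"] d by simp
  qed
qed

lemma rho_in_range: "d \<in> rotation_range k \<Longrightarrow> rho k d \<in> rotation_range k"
  by (erule rotation_range_cases) (use k in \<open>simp_all add: rho_def rotation_range_def\<close>)

lemma rho_diff_in_range: "d \<in> rotation_range k \<Longrightarrow> rho k d - d \<in> rotation_range k"
  by (erule rotation_range_cases) (use k in \<open>simp_all add: rho_def rotation_range_def\<close>)

text \<open>
  If \<open>(0, d, rho k d)\<close> is an oriented triangle, then translation by \<open>- d\<close> turns it into an oriented triangle with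
  the directed edge from 0 to \<open>rho k d - d\<close> and third vertex \<open>- d\<close>.
\<close>

lemma rho_rho_diff: "d \<in> rotation_range k \<Longrightarrow> rho k (rho k d - d) = - d"
  by (erule rotation_range_cases) (use k in \<open>simp_all add: rho_def\<close>)

text \<open>
  Starting at 1, the map \<^const>\<open>rho\<close> reaches the whole range.
\<close>

lemma rho_reach:
  assumes closed: "\<And>d. P d \<Longrightarrow> P (rho k d)" and one: "P 1" and d: "d \<in> rotation_range k"
  shows "P d"
proof -
  have a: "P (3 * k + 2 + j)" "P (2 * j)" "P (j - 5 * k - 3)" if "P (2 * j - 1)" "1 \<le> j" "j \<le> k" for j
  proof -
    show 1: "P (3 * k + 2 + j)" using closed[OF that(1)] rho_simps(1)[OF that(2,3)] by simp
    show 2: "P (2 * j)" using closed[OF 1] rho_simps(3)[OF that(2,3)] by simp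
    show "P (j - 5 * k - 3)" using closed[OF 2] rho_simps(2)[OF that(2,3)] by simp
  qed
  have A: "j \<le> k \<longrightarrow> P (2 * j - 1)" if "1 \<le> j" for j
    using that
  proof (induction j rule: int_ge_induct)
    case base show ?case using one by simp
  next
    case (step j)
    show ?case
    proof
      assume "j + 1 \<le> k"
      then have "P (j - 5 * k - 3)" using a(3)[of j] step by simp
      moreover have "rho k (j - 5 * k - 3) = 2 * (j + 1) - 1"
        using rho_simps(4)[of j] step(1) \<open>j + 1 \<le> k\<close> by simp
      ultimately show "P (2 * (j + 1) - 1)" using closed by metis
    qed
  qed
  have "P (- 4 * k - 3)" using a(3)[of k] A[of k] k by simp
  from closed[OF this] have 6: "P (- 2 * k - 1)" using rho_simps(5) by simp
  from closed[OF this] have "P (3 * k + 2)" using rho_simps(6) by simp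
  from closed[OF this] have neg1: "P (- 1)" using rho_simps(7)[of 0] k by simp
  have b: "P (- 5 * k - 3 - j)" "P (- 2 * j)" "P (3 * k + 2 - j)" if "P (1 - 2 * j)" "1 \<le> j" "j \<le> k" for j
  proof -
    show 1: "P (- 5 * k - 3 - j)" using closed[OF that(1)] rho_simps(8)[OF that(2,3)] by simp
    show 2: "P (- 2 * j)" using closed[OF 1] rho_simps(9)[OF that(2,3)] by simp
    show "P (3 * k + 2 - j)" using closed[OF 2] rho_simps(10)[OF that(2,3)] by simp
  qed
  have B: "j \<le> k \<longrightarrow> P (1 - 2 * j)" if "1 \<le> j" for j
    using that
  proof (induction j rule: int_ge_induct)
    case base show ?case using neg1 by simp
  next
    case (step j)
    show ?case
    proof
      assume "j + 1 \<le> k"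
      then have "P (3 * k + 2 - j)" using b(3)[of j] step by simp
      moreover have "rho k (3 * k + 2 - j) = 1 - 2 * (j + 1)"
        using rho_simps(7)[of j] step(1) \<open>j + 1 \<le> k\<close> by simp
      ultimately show "P (1 - 2 * (j + 1))" using closed by metis
    qed
  qed
  have 11: "P (2 * k + 2)" using b(3)[of k] B[of k] k by simp
  from closed[OF this] have 12: "P (4 * k + 3)" using rho_simps(11) by simp
  have c: "P (6 * k + 4 - j)" "P (4 * k + 3 + j)" if "P (4 * k + 2 + j)" "1 \<le> j" "j \<le> k" for j
  proof -
    show 1: "P (6 * k + 4 - j)" using closed[OF that(1)] rho_simps(12)[OF that(2,3)] by simp
    show "P (4 * k + 3 + j)" using closed[OF 1] rho_simps(13)[OF that(2,3)] by simp
  qed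
  have C: "j \<le> k \<longrightarrow> P (4 * k + 2 + j)" if "1 \<le> j" for j
    using that
  proof (induction j rule: int_ge_induct)
    case base show ?case using 12 by (simp add: add.commute)
  next
    case (step j)
    show ?case using c(2)[of j] step by (auto simp: algebra_simps)
  qed
  have 14: "P (5 * k + 3)" using c(2)[of k] C[of k] k by (simp add: algebra_simps)
  from closed[OF this] have 15: "P (2 * k + 1)" using rho_simps(14) by simp
  from closed[OF this] have 16: "P (- 2 * k - 2)" using rho_simps(15) by simp
  have e: "P (j - 4 * k - 3)" "P (- 2 * k - 2 - j)" if "P (- 2 * k - 1 - j)" "1 \<le> j" "j \<le> k" for j
  proof -
    show 1: "P (j - 4 * k - 3)" using closed[OF that(1)] rho_simps(16)[OF that(2,3)] by simp
    show "P (- 2 * k - 2 - j)" using closed[OF 1] rho_simps(17)[OF that(2,3)] by simp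
  qed
  have E: "j \<le> k \<longrightarrow> P (- 2 * k - 1 - j)" if "1 \<le> j" for j
    using that
  proof (induction j rule: int_ge_induct)
    case base show ?case using 16 by (simp add: algebra_simps)
  next
    case (step j)
    show ?case using e(2)[of j] step by (auto simp: algebra_simps)
  qed
  have "- 3 * k - 2 = - 2 * k - 2 - k" by simp
  moreover have "P (- 2 * k - 2 - k)" using e(2)[of k] E[of k] k by blast
  ultimately have 18: "P (- 3 * k - 2)" by (simp only:)
  from closed[OF this] have 19: "P (- 5 * k - 3)" using rho_simps(18) by simp
  show ?thesis
    using d
  proof (cases rule: rotation_range_cases)
    case (1 j) then show ?thesis using A[of j] by simp
  next
    case (2 j) then show ?thesis using a(2)[of j] A[of j] by simp
  next
    case (3 j) then show ?thesis using a(1)[of j] A[of j] by simp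
  next
    case (4 j) then show ?thesis using a(3)[of j] A[of j] by simp
  next
    case 5 then show ?thesis using \<open>P (- 4 * k - 3)\<close> by simp
  next
    case 6 then show ?thesis using \<open>P (- 2 * k - 1)\<close> by simp
  next
    case (7 j)
    then show ?thesis using b(3)[of j] B[of j] \<open>P (3 * k + 2)\<close> by (cases "j = 0") auto
  next
    case (8 j) then show ?thesis using B[of j] by simp
  next
    case (9 j) then show ?thesis using b(1)[of j] B[of j] by simp
  next
    case (10 j) then show ?thesis using b(2)[of j] B[of j] by simp
  next
    case 11 then show ?thesis using \<open>P (2 * k + 2)\<close> by simp
  next
    case (12 j) then show ?thesis using C[of j] by simp
  next
    case (13 j) then show ?thesis using c(1)[of j] C[of j] by simp
  next
    case 14 then show ?thesis using \<open>P (5 * k + 3)\<close> by simp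
  next
    case 15 then show ?thesis using \<open>P (2 * k + 1)\<close> by simp
  next
    case (16 j) then show ?thesis using E[of j] by simp
  next
    case (17 j) then show ?thesis using e(1)[of j] E[of j] by simp
  next
    case 18 then show ?thesis using \<open>P (- 3 * k - 2)\<close> by simp
  next
    case 19 then show ?thesis using \<open>P (- 5 * k - 3)\<close> by simp
  qed
qed

text \<open>
  The link of 0 is a single cycle; the last value, at \<open>- 5 * k - 3\<close>, closes it up at 1.
\<close>

lemma cyclic_on_rho: "cyclic_on (rho k) (rotation_range k)"
proof (rule cyclic_on_singleI)
  show one: "1 \<in> rotation_range k" using k by (simp add: rotation_range_def)
  have last: "- 5 * k - 3 \<in> rotation_range k" using k by (simp add: rotation_range_def)
  have "\<exists>i. d = (rho k ^^ i) 1" if "d \<in> rotation_range k" for d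
  proof (rule rho_reach[OF _ _ that])
    show "\<exists>i. 1 = (rho k ^^ i) 1" by (intro exI[of _ 0]) simp
    show "\<exists>i. rho k d = (rho k ^^ i) 1" if "\<exists>i. d = (rho k ^^ i) 1" for d
      using that by (metis funpow.simps(2) o_apply)
  qed
  note reach = this
  obtain i where "- 5 * k - 3 = (rho k ^^ i) 1" using reach[OF last] by blast
  then have "(rho k ^^ Suc i) 1 = 1" using rho_simps(19) by (metis funpow.simps(2) o_apply)
  then have self: "1 \<in> orbit (rho k) 1" unfolding orbit_altdef by (auto intro!: exI[of _ "Suc i"] simp del: funpow.simps)
  show "rotation_range k = orbit (rho k) 1"
  proof (intro equalityI subsetI)
    fix d assume "d \<in> rotation_range k"
    then show "d \<in> orbit (rho k) 1" using reach unfolding orbit_altdef_self_in[OF self] by auto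
  next
    fix d assume "d \<in> orbit (rho k) 1"
    then show "d \<in> rotation_range k" by induction (use rho_in_range one in auto)
  qed
qed

end

lemma card_rotation_range:
  assumes "1 \<le> k"
  shows "card (rotation_range (int k)) = 12 * k + 6" "finite (rotation_range (int k))"
proof -
  have *: "rotation_range (int k) = {- (6 * int k + 3)..6 * int k + 3} - {0}"
    by (auto simp: rotation_range_def)
  show "finite (rotation_range (int k))" unfolding * by simp
  have "card (rotation_range (int k)) = card {- (6 * int k + 3)..6 * int k + 3} - 1"
    unfolding * by (subst card_Diff_singleton) auto
  then show "card (rotation_range (int k)) = 12 * k + 6" by simp
qed

text \<open>
  Every generating triangle is one of the triangles \<open>{0, d, rho k d}\<close>.
\<close>

lemma generator_rotation:
  assumes k: "1 \<le> k" and \<sigma>: "\<sigma> \<in> R_generators k"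
  obtains d where "d \<in> rotation_range (int k)" "int ` \<sigma> = {0, d, rho (int k) d}"
proof -
  have k': "1 \<le> int k" using k by simp
  note rho = rho_simps[OF k']
  from \<sigma> show ?thesis
    unfolding R_generators_def
  proof (elim UnE UN_E insertE emptyE)
    fix j assume "j \<in> {1..k}" "\<sigma> = {0, 2*j - 1, 3*k + 2 + j}"
    then show ?thesis using k rho(1)[of "int j"]
      by (intro that[of "2 * int j - 1"]) (auto simp: rotation_range_def of_nat_diff)
  next
    fix j assume "j \<in> {1..k}" "\<sigma> = {0, 2*j, 3*k + 2 + j}"
    then show ?thesis using k rho(3)[of "int j"]
      by (intro that[of "3 * int k + 2 + int j"]) (auto simp: rotation_range_def)
  next
    assume "\<sigma> = {0, 4*k + 3, 6*k + 3}"
    then show ?thesis using k rho(12)[of 1]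
      by (intro that[of "4 * int k + 3"]) (auto simp: rotation_range_def add.commute)
  next
    assume "\<sigma> = {0, 2*k + 2, 4*k + 3}"
    then show ?thesis using k rho(11)
      by (intro that[of "2 * int k + 2"]) (auto simp: rotation_range_def)
  next
    fix j assume "j \<in> {1..k-1}" "\<sigma> = {0, 4*k + 3 + j, 6*k + 3 - j}"
    then show ?thesis using k rho(12)[of "int j + 1"]
      by (intro that[of "4 * int k + 3 + int j"]) (auto simp: rotation_range_def of_nat_diff algebra_simps)
  next
    fix j assume "j \<in> {1..k-1}" "\<sigma> = {0, 4*k + 3 + j, 6*k + 4 - j}"
    moreover from this have "1 \<le> int j" "int j \<le> int k" by auto
    ultimately show ?thesis using k rho(13)[of "int j"]
      by (intro that[of "6 * int k + 4 - int j"]) (auto simp: rotation_range_def of_nat_diff)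
  next
    assume "\<sigma> = {0, 2*k + 1, 5*k + 3}"
    then show ?thesis using k rho(14)
      by (intro that[of "5 * int k + 3"]) (auto simp: rotation_range_def)
  next
    assume "\<sigma> = {0, 5*k + 3, 5*k + 4}"
    then show ?thesis using k rho(13)[of "int k"]
      by (intro that[of "5 * int k + 4"]) (auto simp: rotation_range_def algebra_simps)
  qed
qed

lemma R_generatorsI:
  "j \<in> {1..k} \<Longrightarrow> {0, 2*j - 1, 3*k + 2 + j} \<in> R_generators k"
  "j \<in> {1..k} \<Longrightarrow> {0, 2*j, 3*k + 2 + j} \<in> R_generators k"
  "{0, 4*k + 3, 6*k + 3} \<in> R_generators k"
  "{0, 2*k + 2, 4*k + 3} \<in> R_generators k"
  "j \<in> {1..k-1} \<Longrightarrow> {0, 4*k + 3 + j, 6*k + 3 - j} \<in> R_generators k"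
  "j \<in> {1..k-1} \<Longrightarrow> {0, 4*k + 3 + j, 6*k + 4 - j} \<in> R_generators k"
  "{0, 2*k + 1, 5*k + 3} \<in> R_generators k"
  "{0, 5*k + 3, 5*k + 4} \<in> R_generators k"
  unfolding R_generators_def
  by (rule UnI1, rule UnI1, rule UnI1, rule UN_I, assumption, rule insertI1,
      rule UnI1, rule UnI1, rule UnI1, rule UN_I, assumption, rule insertI2, rule insertI1,
      rule UnI1, rule UnI1, rule UnI2, rule insertI1,
      rule UnI1, rule UnI1, rule UnI2, rule insertI2, rule insertI1,
      rule UnI1, rule UnI2, rule UN_I, assumption, rule insertI1,
      rule UnI1, rule UnI2, rule UN_I, assumption, rule insertI2, rule insertI1,
      rule UnI2, rule insertI1,
      rule UnI2, rule insertI2, rule insertI1)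

text \<open>
  The triangle \<open>{0, d, rho k d}\<close> is an integer translate of a generating triangle.
\<close>

definition generator_translate :: "nat \<Rightarrow> int \<Rightarrow> bool" where
  "generator_translate k d \<longleftrightarrow> (\<exists>\<sigma>\<in>R_generators k. \<exists>u. {0, d, rho (int k) d} = (\<lambda>x. int x + u) ` \<sigma>)"

lemma generator_translate_next:
  assumes k: "1 \<le> k" and d: "d \<in> rotation_range (int k)" and g: "generator_translate k (rho (int k) d - d)"
  shows "generator_translate k d"
proof -
  obtain \<sigma> u where \<sigma>: "\<sigma> \<in> R_generators k"
    and eq: "{0, rho (int k) d - d, rho (int k) (rho (int k) d - d)} = (\<lambda>x. int x + u) ` \<sigma>"
    using g unfolding generator_translate_def by blast
  have "rho (int k) (rho (int k) d - d) = - d" using rho_rho_diff[of "int k" d] k d by simp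
  then have "{0, d, rho (int k) d} = (\<lambda>x. x + d) ` {0, rho (int k) d - d, rho (int k) (rho (int k) d - d)}"
    by auto
  also have "\<dots> = (\<lambda>x. int x + (u + d)) ` \<sigma>" unfolding eq image_image by (simp add: add.assoc)
  finally show ?thesis unfolding generator_translate_def using \<sigma> by blast
qed

lemma generator_translateI:
  assumes "\<sigma> \<in> R_generators k" "int ` \<sigma> = {0, d, rho (int k) d}"
  shows "generator_translate k d"
  unfolding generator_translate_def using assms by (intro bexI[of _ \<sigma>] exI[of _ 0]) simp_all

text \<open>
  For every \<open>d\<close>, one of the three directed edges of the oriented triangle starts at the vertex 0 of a generating
  triangle. The values of \<open>d\<close> for which this holds directly come first; each of the others is traced back to
  them by replacing \<open>d\<close> with \<open>rho k d - d\<close> at most twice.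
\<close>

lemma rotation_generator_translate:
  assumes k: "1 \<le> k" and d: "d \<in> rotation_range (int k)"
  shows "generator_translate k d"
proof -
  let ?k = "int k"
  have k': "1 \<le> ?k" using k by simp
  note rho = rho_simps[OF k']
  have c1: "generator_translate k (2 * j - 1)" "generator_translate k (3 * ?k + 2 + j)" if j: "1 \<le> j" "j \<le> ?k" for j
  proof -
    define i where "i = nat j"
    then have i: "j = int i" using j by simp
    then have ik: "i \<in> {1..k}" using j by auto
    show "generator_translate k (2 * j - 1)"
      by (rule generator_translateI[OF R_generatorsI(1)[OF ik]]) (use rho(1)[OF j] j in \<open>auto simp: i of_nat_diff\<close>)
    show "generator_translate k (3 * ?k + 2 + j)"
      by (rule generator_translateI[OF R_generatorsI(2)[OF ik]]) (use rho(3)[OF j] j in \<open>auto simp: i\<close>)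
  qed
  have c13: "generator_translate k (6 * ?k + 4 - j)" if j: "1 \<le> j" "j \<le> ?k" for j
  proof -
    define i where "i = nat j"
    then have i: "j = int i" using j by simp
    have "{0, 4*k + 3 + i, 6*k + 4 - i} \<in> R_generators k"
    proof (cases "i = k")
      case True
      then have "4 * k + 3 + i = 5 * k + 3" "6 * k + 4 - i = 5 * k + 4" by auto
      then show ?thesis using R_generatorsI(8)[of k] by (simp add: insert_commute)
    next
      case False
      then have "i \<in> {1..k-1}" using j by (auto simp: i)
      then show ?thesis by (rule R_generatorsI(6))
    qed
    then show ?thesis
      by (rule generator_translateI) (use rho(13)[OF j] j in \<open>auto simp: i of_nat_diff\<close>)
  qed
  have c12: "generator_translate k (4 * ?k + 2 + j)" if j: "1 \<le> j" "j \<le> ?k" for j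
  proof -
    define i where "i = nat j"
    then have i: "j = int i" using j by simp
    have "{0, 4*k + 2 + i, 6*k + 4 - i} \<in> R_generators k"
    proof (cases "i = 1")
      case True
      then have "4 * k + 2 + i = 4 * k + 3" "6 * k + 4 - i = 6 * k + 3" by auto
      then show ?thesis using R_generatorsI(3)[of k] by (simp only:)
    next
      case False
      then have "i - 1 \<in> {1..k-1}" using j by (auto simp: i)
      then have "{0, 4*k + 3 + (i - 1), 6*k + 3 - (i - 1)} \<in> R_generators k" by (rule R_generatorsI(5))
      moreover have "4*k + 3 + (i - 1) = 4*k + 2 + i" "6*k + 3 - (i - 1) = 6*k + 4 - i" using j i by auto
      ultimately show ?thesis by (simp only:)
    qed
    then show ?thesis
      by (rule generator_translateI) (use rho(12)[OF j] j in \<open>auto simp: i of_nat_diff\<close>)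
  qed
  have c11: "generator_translate k (2 * ?k + 2)"
    by (rule generator_translateI[OF R_generatorsI(4)]) (use rho(11) in auto)
  have c14: "generator_translate k (5 * ?k + 3)"
    by (rule generator_translateI[OF R_generatorsI(7)]) (use rho(14) in auto)
  have step: "generator_translate k d" if "rho ?k d = r" "r - d = e" "generator_translate k e" "d \<in> rotation_range ?k" for d r e
    using generator_translate_next[OF k that(4)] that by simp
  have c5: "generator_translate k (- 4 * ?k - 3)"
    by (rule step[OF rho(5) _ c11]) (use k in \<open>auto simp: rotation_range_def\<close>)
  have c6: "generator_translate k (- 2 * ?k - 1)"
    by (rule step[OF rho(6) _ c14]) (use k in \<open>auto simp: rotation_range_def\<close>)
  have c10: "generator_translate k (- 2 * j)" if j: "1 \<le> j" "j \<le> ?k" for j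
    by (rule step[OF rho(10)[OF j] _ c1(2)[OF j]]) (use k j in \<open>auto simp: rotation_range_def\<close>)
  have c17: "generator_translate k (j - 4 * ?k - 3)" if j: "1 \<le> j" "j \<le> ?k" for j
    by (rule step[OF rho(17)[OF j] _ c1(1)[of "?k + 1 - j"]]) (use k j in \<open>auto simp: rotation_range_def\<close>)
  have c4: "generator_translate k (j - 5 * ?k - 3)" if j: "1 \<le> j" "j < ?k" for j
    by (rule step[OF rho(4)[OF j] _ c13[of "?k - j"]]) (use k j in \<open>auto simp: rotation_range_def\<close>)
  have c19: "generator_translate k (- 5 * ?k - 3)"
    by (rule step[OF rho(19) _ c13[of "?k"]]) (use k in \<open>auto simp: rotation_range_def\<close>)
  have c9: "generator_translate k (- 5 * ?k - 3 - j)" if j: "1 \<le> j" "j \<le> ?k" for j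
    by (rule step[OF rho(9)[OF j] _ c12[of "?k + 1 - j"]]) (use k j in \<open>auto simp: rotation_range_def\<close>)
  show ?thesis
  proof (cases rule: rotation_range_cases[OF k' d])
    case (1 j) then show ?thesis using c1 by simp
  next
    case (2 j)
    then show ?thesis
      by (simp only:) (rule step[OF rho(2)[OF 2(1,2)] _ c9[of j]], use k 2 in \<open>auto simp: rotation_range_def\<close>)
  next
    case (3 j) then show ?thesis using c1 by simp
  next
    case (4 j) then show ?thesis using c4 by simp
  next
    case 5 then show ?thesis using c5 by simp
  next
    case 6 then show ?thesis using c6 by simp
  next
    case (7 j)
    then show ?thesis
      by (simp only:) (rule step[OF rho(7)[OF 7(1,2)] _ c17[of "?k - j"]], use k 7 in \<open>auto simp: rotation_range_def\<close>)
  next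
    case (8 j)
    have "generator_translate k (j - 1 - 5 * ?k - 3)" using c4[of "j - 1"] c19 8 by (cases "j = 1") auto
    then show ?thesis unfolding 8(3)
      by (intro step[OF rho(8)[OF 8(1,2)], of "j - 1 - 5 * ?k - 3"]) (use k 8 in \<open>auto simp: rotation_range_def\<close>)
  next
    case (9 j) then show ?thesis using c9 by simp
  next
    case (10 j) then show ?thesis using c10 by simp
  next
    case 11 then show ?thesis using c11 by simp
  next
    case (12 j) then show ?thesis using c12 by simp
  next
    case (13 j) then show ?thesis using c13 by simp
  next
    case 14 then show ?thesis using c14 by simp
  next
    case 15
    then show ?thesis
      by (simp only:) (rule step[OF rho(15) _ c5], use k in \<open>auto simp: rotation_range_def\<close>)
  next
    case (16 j)
    then show ?thesis
      by (simp only:) (rule step[OF rho(16)[OF 16(1,2)] _ c10[of "?k + 1 - j"]], use k 16 in \<open>auto simp: rotation_range_def\<close>)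
  next
    case (17 j) then show ?thesis using c17 by simp
  next
    case 18
    then show ?thesis
      by (simp only:) (rule step[OF rho(18) _ c6], use k in \<open>auto simp: rotation_range_def\<close>)
  next
    case 19 then show ?thesis using c19 by simp
  qed
qed

section \<open>The cyclic triangulations\<close>

text \<open>
  The representative of the residue class of an integer among the vertices \<open>0, \<dots>, n - 1\<close>.
\<close>

definition residue_of :: "nat \<Rightarrow> int \<Rightarrow> nat" where
  "residue_of n d = nat (d mod int n)"

lemma residue_of_lt: "0 < n \<Longrightarrow> residue_of n d < n"
  by (simp add: residue_of_def nat_less_iff)

lemma residue_of_eq_iff: "0 < n \<Longrightarrow> residue_of n a = residue_of n b \<longleftrightarrow> int n dvd a - b"
  by (simp add: residue_of_def eq_nat_nat_iff mod_eq_dvd_iff)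

lemma residue_of_int: "v < n \<Longrightarrow> residue_of n (int v) = v"
  by (simp add: residue_of_def)

lemma residue_of_add: "0 < n \<Longrightarrow> residue_of n (int (residue_of n a) + b) = residue_of n (a + b)"
  by (simp add: residue_of_def mod_add_left_eq)

lemma residue_of_nat: "residue_of n (int x + int t) = (x + t) mod n"
  by (simp add: residue_of_def flip: of_nat_add of_nat_mod)

text \<open>
  The bound \<open>12 * k + 7 \<le> n\<close> is exactly what keeps the \<open>12 * k + 6\<close> nonzero differences in the range of the
  rotation, and 0, distinct modulo \<open>n\<close>.
\<close>

locale R_surface =
  fixes k n :: nat
  assumes k: "1 \<le> k" and n: "12 * k + 7 \<le> n"
begin

abbreviation "D \<equiv> rotation_range (int k)"
abbreviation "\<rho> \<equiv> rho (int k)"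
abbreviation "res \<equiv> residue_of n"

text \<open>
  The triangle with the directed edge from \<open>t\<close> to \<open>t + d\<close>, reduced modulo \<open>n\<close>.
\<close>

definition R_triangle :: "int \<Rightarrow> int \<Rightarrow> nat set" where
  "R_triangle t d = {res t, res (t + d), res (t + \<rho> d)}"

lemma n_pos: "0 < n" using n by simp

lemma int_k: "1 \<le> int k" using k by simp

lemma rho_D: "d \<in> D \<Longrightarrow> \<rho> d \<in> D"
  using rho_in_range[OF int_k] .

lemma next_D: "d \<in> D \<Longrightarrow> \<rho> d - d \<in> D"
  using rho_diff_in_range[OF int_k] .

lemma rho_next: "d \<in> D \<Longrightarrow> \<rho> (\<rho> d - d) = - d"
  using rho_rho_diff[OF int_k] .

lemma res_inj:
  assumes "d \<in> D" "e \<in> D" "res (t + d) = res (t + e)"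
  shows "d = e"
proof -
  have "int n dvd d - e" using assms(3) residue_of_eq_iff[OF n_pos] by simp
  moreover have "\<bar>d - e\<bar> < int n" using assms(1,2) n by (auto simp: rotation_range_def)
  ultimately show ?thesis using dvd_imp_le_int[of "d - e" "int n"] by fastforce
qed

lemma res_neq:
  assumes "d \<in> D"
  shows "res (t + d) \<noteq> res t"
proof
  assume "res (t + d) = res t"
  then have "int n dvd d" using residue_of_eq_iff[OF n_pos] by simp
  moreover have "\<bar>d\<bar> < int n" "d \<noteq> 0" using assms n by (auto simp: rotation_range_def)
  ultimately show False using dvd_imp_le_int[of d "int n"] by fastforce
qed

lemma R_triangle_next:
  assumes "d \<in> D"
  shows "R_triangle (t + d) (\<rho> d - d) = R_triangle t d"
  using rho_next[OF assms] by (auto simp: R_triangle_def)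

lemma R_triangle_res: "R_triangle (int (res t)) d = R_triangle t d"
  using residue_of_add[OF n_pos, of t] residue_of_add[OF n_pos, of t 0] by (simp add: R_triangle_def)

text \<open>
  Every triangle can be described from any of its three vertices.
\<close>

lemma R_triangle_at_vertex:
  assumes d: "d \<in> D" and v: "v \<in> R_triangle t d"
  obtains e where "e \<in> D" "R_triangle t d = R_triangle (int v) e"
proof -
  define e where "e = \<rho> d - d"
  have e: "e \<in> D" "\<rho> e = - d" using next_D[OF d] rho_next[OF d] by (simp_all add: e_def)
  have f: "\<rho> e - e \<in> D" using next_D[OF e(1)] .
  have te: "R_triangle (t + d) e = R_triangle t d" unfolding e_def using d by (rule R_triangle_next)
  have "R_triangle (t + d + e) (\<rho> e - e) = R_triangle t d" using R_triangle_next[OF e(1), of "t + d"] te by simp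
  then have tf: "R_triangle (t + \<rho> d) (\<rho> e - e) = R_triangle t d" by (simp add: e_def)
  consider "v = res t" | "v = res (t + d)" | "v = res (t + \<rho> d)" using v by (auto simp: R_triangle_def)
  then show ?thesis
  proof cases
    case 1 then show ?thesis using that[OF d] R_triangle_res by simp
  next
    case 2 then show ?thesis using that[OF e(1)] R_triangle_res te by simp
  next
    case 3 then show ?thesis using that[OF f] R_triangle_res tf by simp
  qed
qed

lemma R_triangles_eq: "R_triangles k n = {R_triangle t d | t d. d \<in> D}"
proof (intro equalityI subsetI)
  fix \<tau> assume "\<tau> \<in> R_triangles k n"
  then obtain \<sigma> t where \<sigma>: "\<sigma> \<in> R_generators k" "\<tau> = (\<lambda>x. (x + t) mod n) ` \<sigma>"
    unfolding R_triangles_def by blast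
  obtain d where d: "d \<in> D" "int ` \<sigma> = {0, d, \<rho> d}" using generator_rotation[OF k \<sigma>(1)] by blast
  have "\<tau> = (\<lambda>x. res (x + int t)) ` int ` \<sigma>"
    unfolding \<sigma>(2) image_image by (simp add: residue_of_nat)
  then have "\<tau> = R_triangle (int t) d" unfolding d(2) by (simp add: R_triangle_def add.commute)
  then show "\<tau> \<in> {R_triangle t d | t d. d \<in> D}" using d(1) by blast
next
  fix \<tau> assume "\<tau> \<in> {R_triangle t d | t d. d \<in> D}"
  then obtain t d where d: "d \<in> D" "\<tau> = R_triangle t d" by blast
  obtain \<sigma> u where \<sigma>: "\<sigma> \<in> R_generators k" "{0, d, \<rho> d} = (\<lambda>x. int x + u) ` \<sigma>"
    using rotation_generator_translate[OF k d(1)] unfolding generator_translate_def by blast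
  define s where "s = res (t + u)"
  have "\<tau> = (\<lambda>x. res (t + x)) ` {0, d, \<rho> d}" unfolding d(2) by (simp add: R_triangle_def)
  also have "\<dots> = (\<lambda>x. res (t + u + int x)) ` \<sigma>"
    unfolding \<sigma>(2) image_image by (simp add: algebra_simps)
  also have "\<dots> = (\<lambda>x. res (int s + int x)) ` \<sigma>"
    unfolding s_def by (simp add: residue_of_add[OF n_pos])
  also have "\<dots> = (\<lambda>x. (x + s) mod n) ` \<sigma>"
    by (simp add: residue_of_nat add.commute)
  finally show "\<tau> \<in> R_triangles k n"
    unfolding R_triangles_def using \<sigma>(1) residue_of_lt[OF n_pos] s_def by blast
qed

lemma R_complex_iff: "\<tau> \<in> R_complex k n \<longleftrightarrow> \<tau> \<noteq> {} \<and> (\<exists>t. \<exists>d\<in>D. \<tau> \<subseteq> R_triangle t d)"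
  unfolding R_complex_def R_triangles_eq by blast

lemma R_triangle_bounded: "R_triangle t d \<subseteq> {0..<n}"
  using residue_of_lt[OF n_pos] by (auto simp: R_triangle_def)

lemma R_complex_bounded: "R_complex k n \<subseteq> Pow {0..<n}"
proof
  fix \<sigma> assume "\<sigma> \<in> R_complex k n"
  then obtain t d where "\<sigma> \<subseteq> R_triangle t d" unfolding R_complex_iff by blast
  then show "\<sigma> \<in> Pow {0..<n}" using R_triangle_bounded[of t d] by blast
qed

lemma finite_complex_R: "finite_complex (R_complex k n)"
  unfolding finite_complex_def
proof (intro conjI ballI allI impI)
  show "finite (R_complex k n)" using R_complex_bounded by (rule finite_subset) simp
next
  fix \<sigma> assume "\<sigma> \<in> R_complex k n"
  then have "\<sigma> \<subseteq> {0..<n}" using R_complex_bounded by blast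
  then show "finite \<sigma>" by (rule finite_subset) simp
next
  fix \<sigma> assume "\<sigma> \<in> R_complex k n"
  then show "\<sigma> \<noteq> {}" by (simp add: R_complex_iff)
next
  fix \<sigma> \<tau> assume "\<sigma> \<in> R_complex k n" "\<tau> \<noteq> {} \<and> \<tau> \<subseteq> \<sigma>"
  then show "\<tau> \<in> R_complex k n" unfolding R_complex_iff by blast
qed

lemma one_D: "1 \<in> D" by (simp add: rotation_range_def)

lemma vertices_R: "vertices (R_complex k n) = {0..<n}"
proof
  show "vertices (R_complex k n) \<subseteq> {0..<n}" using R_complex_bounded by blast
  show "{0..<n} \<subseteq> vertices (R_complex k n)"
  proof
    fix v assume "v \<in> {0..<n}"
    then have "{v} \<subseteq> R_triangle (int v) 1" by (simp add: R_triangle_def residue_of_int)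
    then have "{v} \<in> R_complex k n" using one_D unfolding R_complex_iff by blast
    then show "v \<in> vertices (R_complex k n)" by blast
  qed
qed

text \<open>
  The vertex set of the link of \<open>v\<close>.
\<close>

definition nbrs :: "nat \<Rightarrow> nat set" where
  "nbrs v = (\<lambda>d. res (int v + d)) ` D"

text \<open>
  The successor map in the link of \<open>v\<close>: the rotation of differences, carried over to the vertex \<open>v\<close>.
\<close>

definition rot :: "nat \<Rightarrow> nat \<Rightarrow> nat" where
  "rot v x = res (int v + \<rho> (THE d. d \<in> D \<and> res (int v + d) = x))"

lemma rot_eq: "d \<in> D \<Longrightarrow> rot v (res (int v + d)) = res (int v + \<rho> d)"
  unfolding rot_def by (rule arg_cong[where f = "\<lambda>d. res (int v + \<rho> d)"]) (use res_inj in blast)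

lemma card_nbrs: "card (nbrs v) = 12 * k + 6"
proof -
  have "inj_on (\<lambda>d. res (int v + d)) D" using res_inj by (intro inj_onI)
  then show ?thesis using card_rotation_range[OF k] by (simp add: nbrs_def card_image)
qed

lemma link_cycle_R:
  assumes v: "v < n"
  shows "link_cycle (R_complex k n) v (rot v) (nbrs v)"
  unfolding link_cycle_def
proof (intro conjI)
  show "cyclic_on (rot v) (nbrs v)"
    unfolding nbrs_def using cyclic_on_rho[OF int_k]
    by (rule cyclic_on_image) (rule rot_eq)
  show "3 \<le> card (nbrs v)" by (simp add: card_nbrs)
  have v_res: "res (int v) = v" using v by (rule residue_of_int)
  show "v \<notin> nbrs v"
  proof
    assume "v \<in> nbrs v"
    then obtain d where "d \<in> D" "v = res (int v + d)" by (auto simp: nbrs_def)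
    then show False using res_neq[of d "int v"] v_res by metis
  qed
  have tri: "R_triangle (int v) d = {v, x, rot v x}" if "x = res (int v + d)" "d \<in> D" for d x
    using that rot_eq v_res by (simp add: R_triangle_def)
  show "{\<sigma> \<in> R_complex k n. v \<in> \<sigma>} =
      insert {v} ({{v, x} | x. x \<in> nbrs v} \<union> {{v, x, rot v x} | x. x \<in> nbrs v})" (is "?L = ?R")
  proof (intro equalityI subsetI)
    fix \<sigma> assume "\<sigma> \<in> ?L"
    then obtain t d where \<sigma>: "v \<in> \<sigma>" "d \<in> D" "\<sigma> \<subseteq> R_triangle t d" unfolding R_complex_iff by blast
    then obtain e where e: "e \<in> D" "R_triangle t d = R_triangle (int v) e"
      using R_triangle_at_vertex[of d v t] by blast
    define x where "x = res (int v + e)"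
    have x: "x \<in> nbrs v" using e(1) by (simp add: x_def nbrs_def)
    have "rot v x = res (int v + \<rho> e)" using rot_eq[OF e(1)] by (simp add: x_def)
    then have rx: "rot v x \<in> nbrs v" using rho_D[OF e(1)] by (simp add: nbrs_def)
    have "\<sigma> \<subseteq> {v, x, rot v x}" using \<sigma>(3) e(2) tri[OF x_def e(1)] by simp
    then have "\<sigma> = {v} \<or> \<sigma> = {v, x} \<or> \<sigma> = {v, rot v x} \<or> \<sigma> = {v, x, rot v x}" using \<sigma>(1) by blast
    then show "\<sigma> \<in> ?R" using x rx by blast
  next
    fix \<sigma> assume "\<sigma> \<in> ?R"
    moreover have "res (int v + 1) \<in> nbrs v" unfolding nbrs_def using one_D by (rule imageI)
    ultimately obtain x where x: "x \<in> nbrs v" "v \<in> \<sigma>" "\<sigma> \<subseteq> {v, x, rot v x}" by blast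
    obtain d where d: "d \<in> D" "x = res (int v + d)" using x(1) by (auto simp: nbrs_def)
    have "\<sigma> \<subseteq> R_triangle (int v) d" using x(3) tri[OF d(2,1)] by simp
    then show "\<sigma> \<in> ?L" unfolding R_complex_iff using d(1) x(2) by blast
  qed
qed

lemma rot_coherent:
  assumes v: "v < n" and x: "x \<in> nbrs v"
  shows "rot x (rot v x) = v"
proof -
  obtain d where d: "d \<in> D" "x = res (int v + d)" using x by (auto simp: nbrs_def)
  have "rot v x = res (int v + \<rho> d)" using rot_eq d by simp
  also have "\<dots> = res (int x + (\<rho> d - d))" unfolding d(2) by (simp add: residue_of_add[OF n_pos])
  finally have "rot x (rot v x) = res (int x + \<rho> (\<rho> d - d))" using rot_eq[OF next_D[OF d(1)]] by simp
  also have "\<dots> = res (int v)"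
    unfolding rho_next[OF d(1)] d(2) using residue_of_add[OF n_pos, of "int v + d" "- d"] by simp
  finally show ?thesis using v by (simp add: residue_of_int)
qed

text \<open>
  The difference 1 occurs, so consecutive vertices are adjacent.
\<close>

lemma connected_R:
  assumes "u < n" "v < n"
  shows "(u, v) \<in> {(a, b). {a, b} \<in> R_complex k n}\<^sup>*"
proof -
  let ?E = "{(a, b). {a, b} \<in> R_complex k n}"
  have "(0, v) \<in> ?E\<^sup>*" if "v < n" for v
    using that
  proof (induction v)
    case (Suc v)
    have "R_triangle (int v) 1 = {v, Suc v, res (int v + \<rho> 1)}"
      using Suc.prems residue_of_int[of "Suc v" n] residue_of_int[of v n]
      by (simp add: R_triangle_def add.commute)
    then have "{v, Suc v} \<subseteq> R_triangle (int v) 1" by simp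
    then have "{v, Suc v} \<in> R_complex k n" unfolding R_complex_iff using one_D by blast
    then have "(v, Suc v) \<in> ?E" by simp
    then show ?case using Suc by (meson Suc_lessD rtrancl.rtrancl_into_rtrancl)
  qed simp
  moreover have "sym (?E\<^sup>*)" by (intro sym_rtrancl) (auto simp: sym_def insert_commute)
  ultimately show ?thesis using assms by (meson symD rtrancl_trans)
qed

lemma link_cycle_R_vertices: "v \<in> vertices (R_complex k n) \<Longrightarrow> link_cycle (R_complex k n) v (rot v) (nbrs v)"
  using link_cycle_R by (simp add: vertices_R)

lemma dimension_R: "\<sigma> \<in> R_complex k n \<Longrightarrow> card \<sigma> \<le> 3"
  using link_cycle_dimension[OF _ finite_complex_R] link_cycle_R_vertices by blast

lemma degree_R: "v \<in> vertices (R_complex k n) \<Longrightarrow> degree_in (R_complex k n) v = 12 * k + 6"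
  using link_cycle_degree[OF link_cycle_R_vertices] card_nbrs by simp

lemma card_triangles_R:
  "v \<in> vertices (R_complex k n) \<Longrightarrow> card {\<sigma> \<in> triangles (R_complex k n). v \<in> \<sigma>} = 12 * k + 6"
  using link_cycle_card_triangles[OF link_cycle_R_vertices] card_nbrs by simp

lemma closed_surface_R: "closed_surface (underlying_space (R_complex k n))"
proof (rule closed_surface_if_link_cycles[OF finite_complex_R])
  have "0 \<in> vertices (R_complex k n)" using n_pos by (simp add: vertices_R)
  then show "R_complex k n \<noteq> {}" by blast
qed (use link_cycle_R_vertices connected_R vertices_R in auto)

lemma triangulates_R: "triangulates (R_complex k n) (underlying_space (R_complex k n))"
  unfolding triangulates_def using finite_complex_R closed_surface_R homeomorphic_space_refl by blast

lemma triangulates_stack_R: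
  "triangulates (stack_all (R_complex k n)) (underlying_space (R_complex k n))"
  unfolding triangulates_def
  using finite_complex_stack_all[OF finite_complex_R dimension_R] closed_surface_R
    stack_all_homeomorphic[OF finite_complex_R dimension_R] by blast

lemma orientable_R: "orientable (R_complex k n)"
  by (rule orientable_if_coherent[OF link_cycle_R_vertices]) (auto simp: vertices_R rot_coherent)

lemma euler_char_R: "euler_char (R_complex k n) = - 2 * int k * int n"
  using euler_char_equivelar[OF finite_complex_R dimension_R degree_R card_triangles_R]
  by (simp add: vertices_R algebra_simps)

text \<open>
  Every vertex has only \<open>12 * k + 6\<close> neighbours.
\<close>

lemma not_neighborly_R:
  assumes "12 * k + 8 \<le> n"
  shows "\<not> neighborly (R_complex k n)"
proof
  assume *: "neighborly (R_complex k n)"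
  have 0: "0 \<in> vertices (R_complex k n)" using n_pos by (simp add: vertices_R)
  have "(\<lambda>u. {0, u}) ` {1..<n} \<subseteq> {e \<in> edges (R_complex k n). 0 \<in> e}"
    using * 0 unfolding neighborly_def vertices_R by auto
  moreover have "finite {e \<in> edges (R_complex k n). 0 \<in> e}"
    using finite_complex_R by (simp add: edges_def finite_complex_def)
  ultimately have "card ((\<lambda>u. {0, u}) ` {1..<n}) \<le> degree_in (R_complex k n) 0"
    unfolding degree_in_def by (intro card_mono)
  moreover have "card ((\<lambda>u. {0, u}) ` {1..<n}) = n - 1"
    by (subst card_image) (auto simp: inj_on_def doubleton_eq_iff)
  ultimately show False using degree_R[OF 0] assms by simp
qed

text \<open>
  The group acts by translations.
\<close>

lemma cyclic_R: "cyclic (R_complex k n)"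
proof -
  let ?E = "{0..<n}" and ?Z = "integer_mod_group n"
  let ?\<phi> = "\<lambda>g. \<lambda>x\<in>{0..<n}. res (int x + g)"
  have "inj_on (\<lambda>x. res (int x + g)) ?E" for g
  proof (rule inj_onI)
    fix x y assume xy: "x \<in> ?E" "y \<in> ?E" "res (int x + g) = res (int y + g)"
    then have "int n dvd int x - int y" using residue_of_eq_iff[OF n_pos] by simp
    then have "res (int x) = res (int y)" using residue_of_eq_iff[OF n_pos] by simp
    then show "x = y" using xy by (simp add: residue_of_int)
  qed
  then have inj: "inj_on (?\<phi> g) ?E" for g by (simp add: inj_on_def)
  have bij: "?\<phi> g \<in> Bij ?E" for g
  proof -
    have "?\<phi> g ` ?E \<subseteq> ?E" using residue_of_lt[OF n_pos] by auto
    then have "?\<phi> g ` ?E = ?E" using inj by (intro endo_inj_surj) auto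
    then show ?thesis using inj unfolding Bij_def bij_betw_def by simp
  qed
  have carrier: "carrier ?Z = {0..<int n}" using n_pos by (simp add: carrier_integer_mod_group)
  have hom: "?\<phi> ((g + h) mod int n) = compose ?E (?\<phi> g) (?\<phi> h)" for g h
  proof
    fix x
    have "res (int x + (g + h) mod int n) = res (int x + (g + h))"
      by (simp add: residue_of_def mod_add_right_eq)
    also have "\<dots> = res (int (res (int x + h)) + g)"
      using residue_of_add[OF n_pos, of "int x + h" g] by (simp add: ac_simps)
    finally show "?\<phi> ((g + h) mod int n) x = compose ?E (?\<phi> g) (?\<phi> h) x"
      using residue_of_lt[OF n_pos] by (simp add: compose_def)
  qed
  have "?\<phi> \<in> hom ?Z (BijGroup ?E)"
    using bij hom by (auto simp: hom_def BijGroup_def)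
  then have act: "group_action ?Z ?E ?\<phi>"
    by (simp add: group_action_def group_hom_def group_hom_axioms_def group_BijGroup)
  have "\<exists>g\<in>carrier ?Z. ?\<phi> g x = y" if "x \<in> ?E" "y \<in> ?E" for x y
  proof
    have "res (int x + (int y - int x) mod int n) = res (int y)"
      by (simp add: residue_of_def mod_add_right_eq)
    then show "?\<phi> ((int y - int x) mod int n) x = y" using that by (simp add: residue_of_int)
    show "(int y - int x) mod int n \<in> carrier ?Z" using n_pos by (simp add: carrier)
  qed
  then have trans: "transitive_action ?Z ?E ?\<phi>"
    using act by (simp add: transitive_action_def transitive_action_axioms_def)
  have inv: "(\<lambda>\<sigma>. ?\<phi> g ` \<sigma>) ` R_complex k n = R_complex k n" for g
  proof (rule endo_inj_surj)
    show "finite (R_complex k n)" using R_complex_bounded by (rule finite_subset) simp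
    show "inj_on (\<lambda>\<sigma>. ?\<phi> g ` \<sigma>) (R_complex k n)"
      using inj_on_image_Pow[OF inj] R_complex_bounded by (rule inj_on_subset)
    show "(\<lambda>\<sigma>. ?\<phi> g ` \<sigma>) ` R_complex k n \<subseteq> R_complex k n"
    proof
      fix \<tau> assume "\<tau> \<in> (\<lambda>\<sigma>. ?\<phi> g ` \<sigma>) ` R_complex k n"
      then obtain \<sigma> where \<sigma>: "\<sigma> \<in> R_complex k n" "\<tau> = ?\<phi> g ` \<sigma>" by blast
      then obtain t d where d: "\<sigma> \<noteq> {}" "d \<in> D" "\<sigma> \<subseteq> R_triangle t d" unfolding R_complex_iff by blast
      have "\<tau> \<subseteq> ?\<phi> g ` R_triangle t d" using \<sigma>(2) d(3) by blast
      also have "\<dots> = (\<lambda>x. res (int x + g)) ` R_triangle t d"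
        using R_triangle_bounded[of t d] by (intro image_cong) auto
      also have "\<dots> = R_triangle (t + g) d"
        by (simp add: R_triangle_def residue_of_add[OF n_pos]) (simp add: ac_simps)
      finally show "\<tau> \<in> R_complex k n" unfolding R_complex_iff using \<sigma>(2) d(1,2) by blast
    qed
  qed
  show ?thesis
    unfolding cyclic_def vertices_R using trans inv by (intro exI[of _ ?\<phi>]) simp
qed

end


section \<open>The two subseries\<close>

lemma isomorphic_card_vertices:
  assumes "isomorphic K L"
  shows "card (vertices K) = card (vertices L)"
  using assms bij_betw_same_card unfolding isomorphic_def by blast

text \<open>
  Since \<open>49 + 48 * k * n\<close> lies between \<open>(7 + 24 * k)\<^sup>2\<close>, with equality for \<open>n = 7 + 12 * k\<close>, and \<open>(9 + 24 * k)\<^sup>2\<close>,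
  the floor does not change when \<open>n\<close> is increased from there by 1 or 2.
\<close>

lemma heawood_floor:
  assumes n: "n = 7 + 12 * k + 1 \<or> n = 7 + 12 * k + 2"
  shows "\<lfloor>(5 + sqrt (49 - 24 * real_of_int (- 2 * int k * int n))) / 2\<rfloor> = int (6 + 12 * k)"
proof -
  have x: "49 - 24 * real_of_int (- 2 * int k * int n) = 49 + 48 * real k * real n" by simp
  have n: "real n = 12 * real k + 8 \<or> real n = 12 * real k + 9" using n by auto
  have "(7 + 24 * real k)\<^sup>2 \<le> 49 + 48 * real k * real n"
    using n by (auto simp: power2_eq_square algebra_simps)
  then have lo: "7 + 24 * real k \<le> sqrt (49 + 48 * real k * real n)" by (rule real_le_rsqrt)
  have "49 + 48 * real k * real n < (9 + 24 * real k)\<^sup>2"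
    using n by (auto simp: power2_eq_square algebra_simps)
  then have "sqrt (49 + 48 * real k * real n) < 9 + 24 * real k" by (intro real_less_lsqrt) auto
  with lo show ?thesis unfolding x by (intro floor_unique) auto
qed

theorem corollary11:
  shows "(\<forall>(k::nat) (n::nat) (q::nat) (chi::int).
            k \<ge> 1 \<and> (n = 7 + 12*k + 1 \<or> n = 7 + 12*k + 2) \<and> chi = - 2 * int k * int n \<and> q = 6 + 12*k \<longrightarrow>
              triangulates (R_complex k n) (underlying_space (R_complex k n)) \<and>
              vertices (R_complex k n) = {0..<n} \<and>
              orientable (R_complex k n) \<and>
              euler_char (R_complex k n) = chi \<and>
              \<not> neighborly (R_complex k n) \<and>
              cyclic (R_complex k n) \<and>
              equivelar q (R_complex k n) \<and>
              int q = \<lfloor>(5 + sqrt (49 - 24 * real_of_int chi)) / 2\<rfloor> \<and>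
              triangulates (stack_all (R_complex k n)) (underlying_space (R_complex k n)) \<and>
              orientable (stack_all (R_complex k n)) \<and>
              euler_char (stack_all (R_complex k n)) = chi \<and>
              covered (2 * q) (stack_all (R_complex k n)) \<and>
              int (2 * q) = 2 * \<lfloor>(5 + sqrt (49 - 24 * real_of_int chi)) / 2\<rfloor>) \<and>
         (\<forall>c\<in>{1, 2::nat}.
            infinite {R_complex k (7 + 12*k + c) | k. k \<ge> 1} \<and>
            pairwise (\<lambda>K L. \<not> isomorphic K L) {R_complex k (7 + 12*k + c) | k. k \<ge> 1})"
proof (intro conjI[of "\<forall>k n q chi. _ k n q chi"] allI impI ballI)
  fix k n q :: nat and chi :: int
  assume *: "k \<ge> 1 \<and> (n = 7 + 12*k + 1 \<or> n = 7 + 12*k + 2) \<and> chi = - 2 * int k * int n \<and> q = 6 + 12*k"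
  then have chi: "chi = - 2 * int k * int n" and q: "q = 12 * k + 6" and n8: "12 * k + 8 \<le> n" by auto
  interpret R_surface k n using * by unfold_locales auto
  have floor: "int q = \<lfloor>(5 + sqrt (49 - 24 * real_of_int chi)) / 2\<rfloor>"
    using heawood_floor[of n k] * by simp
  have eq: "equivelar q (R_complex k n)" unfolding equivelar_def q using degree_R by blast
  have cov: "covered (2 * q) (stack_all (R_complex k n))"
    unfolding q using covered_stack_all[OF finite_complex_R degree_R card_triangles_R] .
  show "triangulates (R_complex k n) (underlying_space (R_complex k n)) \<and>
    vertices (R_complex k n) = {0..<n} \<and>
    orientable (R_complex k n) \<and>
    euler_char (R_complex k n) = chi \<and>
    \<not> neighborly (R_complex k n) \<and>
    cyclic (R_complex k n) \<and>
    equivelar q (R_complex k n) \<and>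
    int q = \<lfloor>(5 + sqrt (49 - 24 * real_of_int chi)) / 2\<rfloor> \<and>
    triangulates (stack_all (R_complex k n)) (underlying_space (R_complex k n)) \<and>
    orientable (stack_all (R_complex k n)) \<and>
    euler_char (stack_all (R_complex k n)) = chi \<and>
    covered (2 * q) (stack_all (R_complex k n)) \<and>
    int (2 * q) = 2 * \<lfloor>(5 + sqrt (49 - 24 * real_of_int chi)) / 2\<rfloor>"
  proof (intro conjI)
    show "int (2 * q) = 2 * \<lfloor>(5 + sqrt (49 - 24 * real_of_int chi)) / 2\<rfloor>" using floor by simp
    show "euler_char (stack_all (R_complex k n)) = chi"
      using euler_char_stack_all[OF finite_complex_R] euler_char_R chi by simp
    show "euler_char (R_complex k n) = chi" using euler_char_R chi by simp
  qed (fact triangulates_R vertices_R orientable_R not_neighborly_R[OF n8] cyclic_R eq floor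
      triangulates_stack_R orientable_stack_all[OF orientable_R] cov)+
next
  fix c :: nat
  define R where "R k = R_complex k (7 + 12*k + c)" for k
  have card: "card (vertices (R k)) = 7 + 12*k + c" if "k \<ge> 1" for k
  proof -
    interpret R_surface k "7 + 12*k + c" using that by unfold_locales auto
    show ?thesis unfolding R_def vertices_R by simp
  qed
  have set: "{R_complex k (7 + 12*k + c) | k. k \<ge> 1} = R ` {1..}" by (auto simp: R_def)
  have "inj_on R {1..}"
  proof (rule inj_onI)
    fix k l assume "k \<in> {1..}" "l \<in> {1..}" and eq: "R k = R l"
    then have "1 \<le> k" "1 \<le> l" by simp_all
    from card[OF this(1)] card[OF this(2)] show "k = l" unfolding eq by linarith
  qed
  moreover have "infinite {1::nat..}" by (rule infinite_Ici)
  ultimately have inf: "infinite {R_complex k (7 + 12*k + c) | k. k \<ge> 1}"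
    unfolding set by (simp only: finite_image_iff not_False_eq_True)
  have "pairwise (\<lambda>K L. \<not> isomorphic K L) {R_complex k (7 + 12*k + c) | k. k \<ge> 1}"
    unfolding set
  proof (intro pairwiseI notI)
    fix K L assume KL: "K \<in> R ` {1..}" "L \<in> R ` {1..}" "K \<noteq> L" "isomorphic K L"
    obtain k where k: "k \<in> {1..}" "K = R k" using KL(1) by (rule imageE)
    obtain l where l: "l \<in> {1..}" "L = R l" using KL(2) by (rule imageE)
    have "1 \<le> k" "1 \<le> l" using k(1) l(1) by simp_all
    from card[OF this(1)] card[OF this(2)] have "k = l"
      using isomorphic_card_vertices[OF KL(4)] unfolding k(2) l(2) by linarith
    then show False using k(2) l(2) KL(3) by simp
  qed
  with inf show "infinite {R_complex k (7 + 12*k + c) | k. k \<ge> 1} \<and>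
      pairwise (\<lambda>K L. \<not> isomorphic K L) {R_complex k (7 + 12*k + c) | k. k \<ge> 1}" ..
qed

end
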